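(* Let $\Bbbk$ be a field of characteristic $0$, $V$ an $n$-dimensional $\Bbbk$-vector space with basis $(e_i)_{i=1}^n$, and $x\in\mathrm{Leib}(V)$. Then $\det D_x\neq0$, equivalently $\kappa_R$ is nondegenerate, if and only if $(V,\mu_x)$ is a semisimple Lie algebra.
   Context: $\mathrm{Leib}(V)$ is the set of $x\in\mathrm{Hom}(V\otimes V,V)$ whose product $\mu_x$ satisfies the right Leibniz identity $\mu_x(\mu_x(a,b),c)=\mu_x(\mu_x(a,c),b)+\mu_x(a,\mu_x(b,c))$ for all $a,b,c\in V$. Let $R_a(b)=\mu_x(b,a)$ be right multiplication. The Killing form of the right Leibniz algebra $(V,\mu_x)$ is the symmetric bilinear form $\kappa_R(a,b)=\mathrm{Tr}(R_aR_b)$, with Gram matrix $D_x=(\mathrm{Tr}(R_{e_i}R_{e_j}))_{i,j}$. *)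

theory Defs
  imports "HOL.Vector_Spaces" "Jordan_Normal_Form.Determinant"
begin

text \<open>
  The space \<open>V\<close> is the whole type \<open>'v\<close>, with scalar multiplication \<open>scale\<close>, subject to the
  library locale \<open>vector_space\<close>.  An element \<open>x\<close> of \<open>Hom(V \<otimes> V, V)\<close> is represented by its
  product \<open>\<mu> a b = x (a \<otimes> b)\<close>, i.e. by a bilinear map.
\<close>

definition bilinear_product ::
  "('k::field \<Rightarrow> 'v::ab_group_add \<Rightarrow> 'v) \<Rightarrow> ('v \<Rightarrow> 'v \<Rightarrow> 'v) \<Rightarrow> bool" where
  "bilinear_product scale \<mu> \<longleftrightarrow>
     (\<forall>a. Vector_Spaces.linear scale scale (\<lambda>b. \<mu> a b)) \<and>
     (\<forall>b. Vector_Spaces.linear scale scale (\<lambda>a. \<mu> a b))"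

definition Leib ::
  "('k::field \<Rightarrow> 'v::ab_group_add \<Rightarrow> 'v) \<Rightarrow> ('v \<Rightarrow> 'v \<Rightarrow> 'v) set" where
  "Leib scale = {\<mu>. bilinear_product scale \<mu> \<and>
     (\<forall>a b c. \<mu> (\<mu> a b) c = \<mu> (\<mu> a c) b + \<mu> a (\<mu> b c))}"

definition right_mult :: "('v \<Rightarrow> 'v \<Rightarrow> 'v) \<Rightarrow> 'v \<Rightarrow> 'v \<Rightarrow> 'v" where
  "right_mult \<mu> a = (\<lambda>b. \<mu> b a)"

text \<open>
  The trace of an endomorphism, computed in the basis \<open>extend_basis {}\<close> of \<open>V\<close> chosen by the
  library.  In finite dimension it may be computed in any basis, see \<open>endo_trace_eq\<close> below.
\<close>

definition endo_trace ::
  "('k::field \<Rightarrow> 'v::ab_group_add \<Rightarrow> 'v) \<Rightarrow> ('v \<Rightarrow> 'v) \<Rightarrow> 'k" where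
  "endo_trace scale f =
     (let B = vector_space.extend_basis scale {}
      in \<Sum>b\<in>B. module.representation scale B (f b) b)"

definition killing_form ::
  "('k::field \<Rightarrow> 'v::ab_group_add \<Rightarrow> 'v) \<Rightarrow> ('v \<Rightarrow> 'v \<Rightarrow> 'v) \<Rightarrow> 'v \<Rightarrow> 'v \<Rightarrow> 'k" where
  "killing_form scale \<mu> a b = endo_trace scale (right_mult \<mu> a \<circ> right_mult \<mu> b)"

definition nondegenerate :: "('v::zero \<Rightarrow> 'v \<Rightarrow> 'k::zero) \<Rightarrow> bool" where
  "nondegenerate \<beta> \<longleftrightarrow>
     (\<forall>a. (\<forall>b. \<beta> a b = 0) \<longrightarrow> a = 0) \<and>
     (\<forall>b. (\<forall>a. \<beta> a b = 0) \<longrightarrow> b = 0)"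

text \<open>The vectors of a basis are indexed from \<open>0\<close>, matching the matrices of the library.\<close>

definition indexed_basis ::
  "('k::field \<Rightarrow> 'v::ab_group_add \<Rightarrow> 'v) \<Rightarrow> nat \<Rightarrow> (nat \<Rightarrow> 'v) \<Rightarrow> bool" where
  "indexed_basis scale n e \<longleftrightarrow>
     inj_on e {..<n} \<and> \<not> module.dependent scale (e ` {..<n}) \<and>
     module.span scale (e ` {..<n}) = UNIV"

definition gram_matrix :: "nat \<Rightarrow> (nat \<Rightarrow> 'v) \<Rightarrow> ('v \<Rightarrow> 'v \<Rightarrow> 'k) \<Rightarrow> 'k mat" where
  "gram_matrix n e \<beta> = mat n n (\<lambda>(i, j). \<beta> (e i) (e j))"

definition lie_algebra ::
  "('k::field \<Rightarrow> 'v::ab_group_add \<Rightarrow> 'v) \<Rightarrow> ('v \<Rightarrow> 'v \<Rightarrow> 'v) \<Rightarrow> bool" where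
  "lie_algebra scale \<mu> \<longleftrightarrow>
     bilinear_product scale \<mu> \<and>
     (\<forall>a. \<mu> a a = 0) \<and>
     (\<forall>a b c. \<mu> a (\<mu> b c) + \<mu> b (\<mu> c a) + \<mu> c (\<mu> a b) = 0)"

definition algebra_ideal ::
  "('k::field \<Rightarrow> 'v::ab_group_add \<Rightarrow> 'v) \<Rightarrow> ('v \<Rightarrow> 'v \<Rightarrow> 'v) \<Rightarrow> 'v set \<Rightarrow> bool" where
  "algebra_ideal scale \<mu> I \<longleftrightarrow>
     module.subspace scale I \<and> (\<forall>a. \<forall>i\<in>I. \<mu> a i \<in> I \<and> \<mu> i a \<in> I)"

primrec derived_series ::
  "('k::field \<Rightarrow> 'v::ab_group_add \<Rightarrow> 'v) \<Rightarrow> ('v \<Rightarrow> 'v \<Rightarrow> 'v) \<Rightarrow> 'v set \<Rightarrow> nat \<Rightarrow> 'v set" where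
  "derived_series scale \<mu> I 0 = I"
| "derived_series scale \<mu> I (Suc k) =
     module.span scale
       {\<mu> a b | a b. a \<in> derived_series scale \<mu> I k \<and> b \<in> derived_series scale \<mu> I k}"

definition solvable_subalgebra ::
  "('k::field \<Rightarrow> 'v::ab_group_add \<Rightarrow> 'v) \<Rightarrow> ('v \<Rightarrow> 'v \<Rightarrow> 'v) \<Rightarrow> 'v set \<Rightarrow> bool" where
  "solvable_subalgebra scale \<mu> I \<longleftrightarrow> (\<exists>k. derived_series scale \<mu> I k = {0})"

text \<open>
  Semisimple means that the solvable radical vanishes, i.e. that there is no nonzero solvable
  ideal.  The zero algebra counts as semisimple (its Gram matrix is empty, of determinant \<open>1\<close>).
\<close>

definition semisimple_lie_algebra ::
  "('k::field \<Rightarrow> 'v::ab_group_add \<Rightarrow> 'v) \<Rightarrow> ('v \<Rightarrow> 'v \<Rightarrow> 'v) \<Rightarrow> bool" where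
  "semisimple_lie_algebra scale \<mu> \<longleftrightarrow>
     lie_algebra scale \<mu> \<and>
     (\<forall>I. algebra_ideal scale \<mu> I \<and> solvable_subalgebra scale \<mu> I \<longrightarrow> I = {0})"

lemma endo_trace_eq:
  fixes scale :: "'k::field \<Rightarrow> 'v::ab_group_add \<Rightarrow> 'v"
  assumes f: "Vector_Spaces.linear scale scale f"
    and B: "finite B" "\<not> module.dependent scale B" "module.span scale B = UNIV"
  shows "endo_trace scale f = (\<Sum>b\<in>B. module.representation scale B (f b) b)"
proof -
  interpret V: vector_space scale using f by (rule Vector_Spaces.linear.axioms(1))
  interpret f: Vector_Spaces.linear scale scale f by (rule f)
  define C where "C = V.extend_basis {}"
  have iC: "V.independent C" and sC: "V.span C = UNIV"
    unfolding C_def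
    by (simp_all add: V.independent_extend_basis V.independent_empty V.span_extend_basis)
  have fC: "finite C"
    using V.independent_span_bound[OF B(1) iC] unfolding B(3) by simp
  have expand: "(\<Sum>b\<in>A. scale (V.representation A v b) b) = v"
    if "finite A" "V.independent A" "V.span A = UNIV" for v A
    using V.sum_representation_eq[of A v A] that by simp
  have swap: "V.representation A (\<Sum>c\<in>S. scale (g c) (h c)) b
      = (\<Sum>c\<in>S. g c * V.representation A (h c) b)"
    if "V.independent A" "V.span A = UNIV" for A S g b and h :: "'v \<Rightarrow> 'v"
    using that by (simp add: V.representation_sum V.representation_scale)
  have fexp: "f b = (\<Sum>c\<in>C. scale (V.representation C b c) (f c))" for b
    by (metis (no_types, lifting) expand[OF fC iC sC] f.scale f.sum sum.cong)
  have "(\<Sum>b\<in>B. V.representation B (f b) b)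
      = (\<Sum>b\<in>B. \<Sum>c\<in>C. V.representation C b c * V.representation B (f c) b)"
    by (rule sum.cong, simp, subst fexp, rule swap[OF B(2,3)])
  also have "\<dots> = (\<Sum>c\<in>C. \<Sum>b\<in>B. V.representation B (f c) b * V.representation C b c)"
    by (subst sum.swap) (simp add: mult.commute)
  also have "\<dots> = (\<Sum>c\<in>C. V.representation C (\<Sum>b\<in>B. scale (V.representation B (f c) b) b) c)"
    by (simp add: swap[OF iC sC])
  also have "\<dots> = (\<Sum>c\<in>C. V.representation C (f c) c)"
    by (simp add: expand[OF B])
  finally show ?thesis
    by (simp add: endo_trace_def C_def Let_def)
qed

end

theory Submission
  imports Defs "HOL-Algebra.Algebraic_Closure_Type" "Jordan_Normal_Form.Jordan_Normal_Form_Existence"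
begin

text \<open>
  Put \<open>R\<^sub>a(b) = [b, a]\<close>; the Leibniz identity says \<open>R\<^bsub>[a,b]\<^esub> = R\<^sub>b R\<^sub>a - R\<^sub>a R\<^sub>b\<close>.  If the Killing form is
  nondegenerate then \<open>R\<^bsub>[a,a]\<^esub> = 0\<close> forces \<open>[a, a] = 0\<close>, so that the algebra is a Lie algebra, and
  an abelian ideal \<open>A\<close> vanishes because \<open>(R\<^sub>a R\<^sub>b)\<^sup>2 = 0\<close> for \<open>a \<in> A\<close>.

  Conversely, let \<open>K\<close> be the radical of the Killing form of a Lie algebra.  If \<open>K\<close> is not solvable, its
  derived series stabilises at an ideal \<open>I = [I, I] \<noteq> 0\<close>.  Over an algebraic closure write
  \<open>R\<^sub>x = P J P\<^sup>-\<^sup>1\<close>, where \<open>x \<in> I\<close> and \<open>J\<close> is in Jordan form with diagonal \<open>d\<^sub>i\<close>, and put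
  \<open>Y = P diag(f(d\<^sub>i)) P\<^sup>-\<^sup>1\<close> for a \<open>\<rat>\<close>-linear functional \<open>f\<close>.  Since \<open>x\<close> is a sum of brackets and the trace
  form vanishes on \<open>I\<close>, we get \<open>0 = Tr(R\<^sub>x Y) = \<Sum> d\<^sub>i f(d\<^sub>i)\<close>, hence \<open>\<Sum> f(d\<^sub>i)\<^sup>2 = 0\<close>; so all \<open>d\<^sub>i\<close> vanish and
  \<open>R\<^sub>x\<close> is nilpotent.  By Engel's theorem \<open>I\<close> is not perfect, a contradiction.
\<close>

unbundle no fps_syntax
hide_const (open) Polynomials.degree

section \<open>Traces of matrices\<close>

definition mtrace :: "'a::comm_monoid_add mat \<Rightarrow> 'a" where
  "mtrace A = (\<Sum>i<dim_row A. A $$ (i, i))"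

lemma mtrace_mult:
  fixes A B :: "'a::comm_semiring_0 mat"
  assumes "A \<in> carrier_mat n m" "B \<in> carrier_mat m n"
  shows "mtrace (A * B) = (\<Sum>i<n. \<Sum>j<m. A $$ (i, j) * B $$ (j, i))"
  using assms by (auto simp: mtrace_def scalar_prod_def lessThan_atLeast0 intro!: sum.cong)

lemma mtrace_comm:
  fixes A B :: "'a::comm_semiring_0 mat"
  assumes "A \<in> carrier_mat n m" "B \<in> carrier_mat m n"
  shows "mtrace (A * B) = mtrace (B * A)"
  unfolding mtrace_mult[OF assms] mtrace_mult[OF assms(2,1)]
  by (subst sum.swap) (simp add: mult.commute)

lemma mtrace_add:
  assumes "A \<in> carrier_mat n n" "B \<in> carrier_mat n n"
  shows "mtrace (A + B) = mtrace A + mtrace B"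
  using assms by (auto simp: mtrace_def sum.distrib)

lemma mtrace_diff:
  fixes A B :: "'a::ab_group_add mat"
  assumes "A \<in> carrier_mat n n" "B \<in> carrier_mat n n"
  shows "mtrace (A - B) = mtrace A - mtrace B"
  using assms by (auto simp: mtrace_def sum_subtractf)

lemma mtrace_smult:
  fixes A :: "'a::semiring_0 mat"
  assumes "A \<in> carrier_mat n n"
  shows "mtrace (c \<cdot>\<^sub>m A) = c * mtrace A"
  using assms by (auto simp: mtrace_def sum_distrib_left)

lemma mtrace_conj:
  fixes A :: "'a::comm_ring_1 mat"
  assumes [simp]: "A \<in> carrier_mat n n" "P \<in> carrier_mat n n" "Q \<in> carrier_mat n n"
    and "Q * P = 1\<^sub>m n"
  shows "mtrace (P * A * Q) = mtrace A"
proof -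
  have "mtrace (P * A * Q) = mtrace (Q * (P * A))"
    by (rule mtrace_comm[of _ n n]) (simp_all add: mult_carrier_mat[of _ n n])
  also have "Q * (P * A) = A"
    by (simp add: assoc_mult_mat[OF assms(3,2,1), symmetric] assms(4) left_mult_one_mat[OF assms(1)])
  finally show ?thesis .
qed

lemma mult_mat_entry:
  assumes "A \<in> carrier_mat n m" "B \<in> carrier_mat m l" "i < n" "j < l"
  shows "(A * B) $$ (i, j) = (\<Sum>k<m. A $$ (i, k) * B $$ (k, j))"
  using assms by (auto simp: scalar_prod_def lessThan_atLeast0)

section \<open>Triangularisation over an algebraically closed field\<close>

text \<open>The columns after the first are all unit vectors except the \<open>p\<close>-th, where
  \<open>v $ p\<close> is nonzero, so together with \<open>v\<close> they form a basis. Row 0 of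
  \<open>W'\<close> reads the coefficient of \<open>v\<close> off the entry at \<open>p\<close>; the
  other rows subtract that multiple of \<open>v\<close>.\<close>

lemma invertible_first_col:
  fixes v :: "'a::field vec"
  assumes v: "v \<in> carrier_vec n" "v \<noteq> 0\<^sub>v n"
  obtains W W' where "W \<in> carrier_mat n n" "W' \<in> carrier_mat n n"
    "W * W' = 1\<^sub>m n" "W' * W = 1\<^sub>m n" "col W 0 = v"
proof -
  from v obtain p where p: "p < n" "v $ p \<noteq> 0"
    by (metis carrier_vecD eq_vecI index_zero_vec(1) index_zero_vec(2))
  \<comment> \<open>\<open>s\<close> is the transposition of 0 and \<open>p\<close>: column 0 is
    taken by \<open>v\<close>, which must displace exactly the \<open>p\<close>-th unit
    vector.\<close>
  define s where "s j = (if j = 0 then p else if j = p then 0 else j)" for j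
  have s: "s j < n" if "j < n" for j using that p by (auto simp: s_def)
  have s_inj: "s i = s j \<longleftrightarrow> i = j" for i j by (auto simp: s_def)
  have s_p: "s j = p \<longleftrightarrow> j = 0" for j by (auto simp: s_def)
  define W where "W = mat n n (\<lambda>(i, j). if j = 0 then v $ i else if i = s j then 1 else 0)"
  define W' where "W' = mat n n (\<lambda>(i, j). if i = 0 then (if j = p then inverse (v $ p) else 0)
     else (if j = s i then 1 else 0) - (if j = p then v $ s i / v $ p else 0))"
  have W: "W \<in> carrier_mat n n" "W' \<in> carrier_mat n n" by (auto simp: W_def W'_def)
  have "W' * W = 1\<^sub>m n"
  proof (rule eq_matI)
    fix i j assume "i < dim_row (1\<^sub>m n :: 'a mat)" "j < dim_col (1\<^sub>m n :: 'a mat)"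
    hence ij: "i < n" "j < n" by auto
    have "(W' * W) $$ (i, j) = (\<Sum>k<n. W' $$ (i, k) * W $$ (k, j))"
      by (rule mult_mat_entry[OF W(2,1) ij])
    also have "\<dots> = (\<Sum>k<n. if i = 0 then (if k = p then inverse (v $ p) * W $$ (p, j) else 0)
        else (if k = s i then W $$ (s i, j) else 0) - (if k = p then v $ s i / v $ p * W $$ (p, j) else 0))"
      using ij by (intro sum.cong refl) (auto simp: W'_def algebra_simps)
    also have "\<dots> = (if i = 0 then inverse (v $ p) * W $$ (p, j)
        else W $$ (s i, j) - v $ s i / v $ p * W $$ (p, j))"
      using p s[OF ij(1)] by (simp add: sum_subtractf)
    also have "\<dots> = 1\<^sub>m n $$ (i, j)"
      using ij p s[OF ij(1)] s_p[of j] by (auto simp: W_def s_inj)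
    finally show "(W' * W) $$ (i, j) = 1\<^sub>m n $$ (i, j)" .
  qed (use W in auto)
  moreover have "W * W' = 1\<^sub>m n" by (rule mat_mult_left_right_inverse[OF W(2,1) calculation])
  moreover have "col W 0 = v" using v p by (intro eq_vecI) (auto simp: W_def)
  ultimately show ?thesis using that W by blast
qed

text \<open>Complete an eigenvector to a basis: the first column becomes a multiple of the first
  unit vector, and induction applies to the lower right block.
  \<open>similar_mat_four_block_0_ex\<close> lifts the similarity of that block at the price of
  changing the upper right one. The Jordan form is computed from this triangular form.\<close>

lemma similar_upper_triangular:
  fixes A :: "'a::alg_closed_field mat"
  assumes "A \<in> carrier_mat n n"
  shows "\<exists>B \<in> carrier_mat n n. upper_triangular B \<and> similar_mat A B"
  using assms
proof (induction n arbitrary: A)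
  case 0
  thus ?case by (intro bexI[of _ A]) (auto intro: similar_mat_refl)
next
  case (Suc n)
  have "degree (char_poly A) > 0" using degree_monic_char_poly[OF Suc.prems] by simp
  from alg_closed_imp_poly_has_root[OF this] obtain a where "poly (char_poly A) a = 0" by blast
  hence "eigenvalue A a" using eigenvalue_root_char_poly[OF Suc.prems] by simp
  then obtain v where v: "v \<in> carrier_vec (Suc n)" "v \<noteq> 0\<^sub>v (Suc n)" "A *\<^sub>v v = a \<cdot>\<^sub>v v"
    using Suc.prems by (auto simp: eigenvalue_def eigenvector_def)
  from invertible_first_col[OF v(1,2)] obtain W W' where W: "W \<in> carrier_mat (Suc n) (Suc n)"
    "W' \<in> carrier_mat (Suc n) (Suc n)" "W * W' = 1\<^sub>m (Suc n)" "W' * W = 1\<^sub>m (Suc n)" "col W 0 = v" .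
  define A' where "A' = W' * A * W"
  have A': "A' \<in> carrier_mat (Suc n) (Suc n)" unfolding A'_def using W Suc.prems by simp
  have "similar_mat_wit A' A W' W"
    by (rule similar_mat_witI[of _ _ "Suc n"]) (use W A' Suc.prems in \<open>auto simp: A'_def\<close>)
  hence AA': "similar_mat A A'" using similar_mat_sym similar_mat_def by blast
  \<comment> \<open>\<open>W'\<close> sends the eigenvector \<open>v\<close>, the first column of
    \<open>W\<close>, to the first unit vector.\<close>
  have "col A' 0 = col (W' * (A * W)) 0"
    unfolding A'_def using W Suc.prems by (simp add: assoc_mult_mat[of _ "Suc n" "Suc n" _ "Suc n" _ "Suc n"])
  also have "\<dots> = W' *\<^sub>v (A *\<^sub>v v)"
    using W Suc.prems by (metis col_mult2 mult_carrier_mat zero_less_Suc)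
  also have "\<dots> = a \<cdot>\<^sub>v (W' *\<^sub>v col W 0)" using v W by (simp add: mult_mat_vec[of _ "Suc n" "Suc n"])
  also have "W' *\<^sub>v col W 0 = col (W' * W) 0" using W by (subst col_mult2[of _ "Suc n" "Suc n"]) auto
  finally have col0: "col A' 0 = a \<cdot>\<^sub>v unit_vec (Suc n) 0" using W by simp
  obtain A1 A2 A0 A3 where split: "split_block A' 1 1 = (A1, A2, A0, A3)"
    by (cases "split_block A' 1 1")
  from split_block[OF split, of n n] A' have blk: "A1 \<in> carrier_mat 1 1" "A2 \<in> carrier_mat 1 n"
    "A0 \<in> carrier_mat n 1" "A3 \<in> carrier_mat n n" "A' = four_block_mat A1 A2 A0 A3" by auto
  have "A0 = 0\<^sub>m n 1"
  proof (rule eq_matI)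
    fix i j assume "i < dim_row (0\<^sub>m n 1 :: 'a mat)" "j < dim_col (0\<^sub>m n 1 :: 'a mat)"
    hence ij: "i < n" "j = 0" by auto
    have "A0 $$ (i, j) = col A' 0 $ Suc i" unfolding blk(5) using ij blk by auto
    also have "\<dots> = 0" unfolding col0 using ij by auto
    finally show "A0 $$ (i, j) = 0\<^sub>m n 1 $$ (i, j)" using ij by simp
  qed (use blk in auto)
  moreover from Suc.IH[OF blk(4)] obtain B3
    where B3: "B3 \<in> carrier_mat n n" "upper_triangular B3" "similar_mat A3 B3" by blast
  moreover from similar_mat_four_block_0_ex[OF similar_mat_refl[OF blk(1)] B3(3) blk(2,1,4)]
  obtain B2 where B2: "B2 \<in> carrier_mat 1 n"
    "similar_mat (four_block_mat A1 A2 (0\<^sub>m n 1) A3) (four_block_mat A1 B2 (0\<^sub>m n 1) B3)" by blast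
  ultimately have "similar_mat A (four_block_mat A1 B2 (0\<^sub>m n 1) B3)"
    using AA' blk(5) similar_mat_trans by metis
  moreover have "upper_triangular (four_block_mat A1 B2 (0\<^sub>m n 1) B3)"
    by (rule upper_triangular_four_block[OF blk(1) B3(1) _ B3(2)])
      (use blk(1) in \<open>auto simp: upper_triangular_def\<close>)
  moreover have "four_block_mat A1 B2 (0\<^sub>m n 1) B3 \<in> carrier_mat (Suc n) (Suc n)"
    using four_block_carrier_mat[OF blk(1) B3(1)] by simp
  ultimately show ?case by blast
qed

text \<open>A nonzero entry lies inside a single Jordan block, and the diagonal of a block is
  constant.\<close>

lemma jordan_matrix_same_diag:
  fixes n_as :: "(nat \<times> 'a::{zero,one}) list"
  assumes "i < sum_list (map fst n_as)" "j < sum_list (map fst n_as)"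
    and "jordan_matrix n_as $$ (i, j) \<noteq> 0"
  shows "jordan_matrix n_as $$ (i, i) = jordan_matrix n_as $$ (j, j)"
  using assms
proof (induction n_as arbitrary: i j)
  case (Cons na n_as)
  obtain n a where na: "na = (n, a)" by force
  let ?N = "sum_list (map fst n_as)"
  have entry: "jordan_matrix ((n, a) # n_as) $$ (k, l) =
      (if k < n then (if l < n then jordan_block n a $$ (k, l) else 0)
       else if l < n then 0 else jordan_matrix n_as $$ (k - n, l - n))"
    if "k < n + ?N" "l < n + ?N" for k l
    using that by (simp add: jordan_matrix_Cons)
  show ?case
  proof (cases "i < n")
    case True
    with Cons.prems have "j < n" "j < n + ?N" by (auto simp: entry na split: if_splits)
    thus ?thesis using True by (simp add: na entry)
  next
    case False
    thus ?thesis using Cons.prems Cons.IH[of "i - n" "j - n"]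
      by (auto simp: entry na split: if_splits)
  qed
qed simp

text \<open>Only two features of the Jordan form are kept: triangularity, and that nonzero entries
  join equal eigenvalues. The second makes the diagonal part commute with \<open>J\<close>.\<close>

lemma similar_block_upper_triangular:
  fixes A :: "'a::alg_closed_field mat"
  assumes A: "A \<in> carrier_mat n n"
  obtains J P Q where "J \<in> carrier_mat n n" "P \<in> carrier_mat n n" "Q \<in> carrier_mat n n"
    "P * Q = 1\<^sub>m n" "Q * P = 1\<^sub>m n" "A = P * J * Q"
    "\<And>i j. i < n \<Longrightarrow> j < i \<Longrightarrow> J $$ (i, j) = 0"
    "\<And>i j. i < n \<Longrightarrow> j < n \<Longrightarrow> J $$ (i, j) \<noteq> 0 \<Longrightarrow> J $$ (i, i) = J $$ (j, j)"
proof -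
  from similar_upper_triangular[OF A] obtain B
    where B: "B \<in> carrier_mat n n" "upper_triangular B" "similar_mat A B" by blast
  define J where "J = jordan_matrix (triangular_to_jnf_vector B)"
  have "similar_mat A J" using triangular_to_jnf_vector[OF B(1,2)] B(3) similar_mat_trans
    unfolding jordan_nf_def J_def by blast
  then obtain P Q where "similar_mat_wit A J P Q" unfolding similar_mat_def by blast
  note w = similar_mat_witD2[OF A this]
  have "sum_list (map fst (triangular_to_jnf_vector B)) = n" using w(5) unfolding J_def by auto
  note N = this
  show ?thesis
  proof (rule that[OF w(5,6,7,1,2,3)])
    show "J $$ (i, j) = 0" if "i < n" "j < i" for i j
      using that N unfolding J_def by (simp add: jordan_matrix_upper_triangular)
    show "J $$ (i, i) = J $$ (j, j)" if "i < n" "j < n" "J $$ (i, j) \<noteq> 0" for i j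
      using that N unfolding J_def by (intro jordan_matrix_same_diag) auto
  qed
qed

section \<open>Generalised eigensequences of the shift\<close>

text \<open>With E the operator that drops the first term of a sequence, this is E - c. Sequences
  killed by one of its powers are generalised eigenvectors of E for c.\<close>

definition shift :: "'a::comm_ring_1 \<Rightarrow> (nat \<Rightarrow> 'a) \<Rightarrow> nat \<Rightarrow> 'a" where
  "shift c t = (\<lambda>j. t (Suc j) - c * t j)"

lemma shift_commute: "shift a (shift b t) = shift b (shift a t)"
  by (auto simp: shift_def algebra_simps)

lemma shift_pow_commute: "(shift a ^^ p) (shift b t) = shift b ((shift a ^^ p) t)"
  by (induction p) (simp_all add: shift_commute)

lemma shift_pow_pow_commute: "(shift a ^^ p) ((shift b ^^ q) t) = (shift b ^^ q) ((shift a ^^ p) t)"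
  by (induction q) (simp_all add: shift_pow_commute)

lemma shift_pow_zero [simp]: "(shift c ^^ p) (\<lambda>_. 0) = (\<lambda>_. 0)"
  by (induction p) (simp_all add: shift_def)

lemma shift_pow_sum:
  "(shift c ^^ p) (\<lambda>j. \<Sum>i\<in>A. t i j) = (\<lambda>j. \<Sum>i\<in>A. (shift c ^^ p) (t i) j)"
proof (induction p)
  case (Suc p)
  show ?case unfolding funpow.simps o_apply Suc.IH
    by (simp add: shift_def sum_subtractf sum_distrib_left)
qed simp

text \<open>Factors \<open>shift a\<close> are stripped off one at a time: what a single factor
  kills is geometric with ratio \<open>a\<close>, and on it \<open>shift b\<close> is multiplication
  by the nonzero number \<open>a - b\<close>.\<close>

lemma shift_pow_eq_0:
  fixes a b :: "'a::idom"
  assumes "a \<noteq> b" "(shift a ^^ p) t = (\<lambda>_. 0)" "(shift b ^^ q) t = (\<lambda>_. 0)"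
  shows "t = (\<lambda>_. 0)"
  using assms(2)
proof (induction p)
  case (Suc p)
  define s where "s = (shift a ^^ p) t"
  have "shift a s = (\<lambda>_. 0)" using Suc.prems by (simp add: s_def)
  hence s_Suc: "s (Suc j) = a * s j" for j by (auto simp: shift_def fun_eq_iff)
  have "(shift b ^^ r) s = (\<lambda>j. (a - b) ^ r * s j)" for r
    by (induction r) (auto simp: shift_def s_Suc algebra_simps)
  moreover have "(shift b ^^ q) s = (\<lambda>_. 0)"
    unfolding s_def shift_pow_pow_commute[where a=b and p=q] assms(3) by simp
  ultimately have "s = (\<lambda>_. 0)" using assms(1) by (auto simp: fun_eq_iff)
  thus ?case using Suc.IH by (simp add: s_def)
qed simp

text \<open>Applying \<open>shift b ^^ m\<close> removes the summand of \<open>b\<close>, induction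
  kills the images of the others, and \<open>shift_pow_eq_0\<close> then kills the others
  themselves.\<close>

lemma generalized_eigensequences_independent:
  fixes t :: "'a::idom \<Rightarrow> nat \<Rightarrow> 'a"
  assumes "finite C" "\<And>c. c \<in> C \<Longrightarrow> (shift c ^^ m) (t c) = (\<lambda>_. 0)"
    and "(\<lambda>j. \<Sum>c\<in>C. t c j) = (\<lambda>_. 0)" "c \<in> C"
  shows "t c = (\<lambda>_. 0)"
  using assms
proof (induction C arbitrary: t c rule: finite_induct)
  case (insert b C)
  have C: "t c = (\<lambda>_. 0)" if "c \<in> C" for c
  proof -
    define u where "u c = (shift b ^^ m) (t c)" for c
    have "(shift b ^^ m) (\<lambda>j. \<Sum>c\<in>insert b C. t c j) = (\<lambda>_. 0)"
      unfolding insert.prems(2) by simp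
    hence "(\<lambda>j. \<Sum>c\<in>insert b C. u c j) = (\<lambda>_. 0)"
      unfolding shift_pow_sum u_def .
    hence "(\<lambda>j. \<Sum>c\<in>C. u c j) = (\<lambda>_. 0)"
      using insert.hyps insert.prems(1)[of b] by (simp add: u_def)
    moreover have "(shift c ^^ m) (u c) = (\<lambda>_. 0)" if "c \<in> C" for c
      unfolding u_def shift_pow_pow_commute[where a=c and p=m] using insert.prems(1)[of c] that by simp
    ultimately have "u c = (\<lambda>_. 0)" using insert.IH[of u] that by blast
    moreover have "b \<noteq> c" using that insert.hyps by blast
    ultimately show ?thesis
      using shift_pow_eq_0[of b c m "t c" m] insert.prems(1)[of c] that by (simp add: u_def)
  qed
  moreover have "t b = (\<lambda>_. 0)"
    using insert.prems(2) insert.hyps C by (simp add: fun_eq_iff)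
  ultimately show ?case using insert.prems(3) by blast
qed simp

section \<open>Replicas\<close>

text \<open>In characteristic 0 the field is a vector space over the rationals. Extend
  \<open>a\<close> to a basis of it and take the coordinate at \<open>a\<close>.\<close>

lemma exists_rational_functional:
  fixes a :: "'a::field_char_0"
  assumes "a \<noteq> 0"
  obtains f :: "'a \<Rightarrow> rat" where "\<And>x y. f (x + y) = f x + f y"
    "\<And>r x. f (of_rat r * x) = r * f x" "f a \<noteq> 0"
proof -
  interpret Q: vector_space "\<lambda>r (x::'a). of_rat r * x"
    by unfold_locales (simp_all add: of_rat_add of_rat_mult algebra_simps)
  have ind: "Q.independent {a}" using assms by simp
  define B where "B = Q.extend_basis {a}"
  have B: "Q.independent B" "Q.span B = UNIV" "a \<in> B"
    using Q.independent_extend_basis[OF ind] Q.span_extend_basis[OF ind] Q.extend_basis_superset[OF ind]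
    by (auto simp: B_def)
  show ?thesis
  proof (rule that[of "\<lambda>x. Q.representation B x a"])
    show "Q.representation B a a \<noteq> 0" using Q.representation_basis[OF B(1,3)] by simp
  qed (use B in \<open>simp_all add: Q.representation_add Q.representation_scale\<close>)
qed

text \<open>
  In terms of the commutator \<open>ad M\<close>, the sequence \<open>W\<close> is \<open>W j = (ad M)\<^sup>j (W 0)\<close>.  By duality for the
  trace form the condition says that \<open>[Y, V]\<close> lies in the span of the \<open>(ad M)\<^sup>j V\<close>.
\<close>

definition replica :: "nat \<Rightarrow> 'a::comm_ring_1 mat \<Rightarrow> 'a mat \<Rightarrow> bool" where
  "replica n M Y \<longleftrightarrow> (\<forall>W V. (\<forall>j. W j \<in> carrier_mat n n \<and> W (Suc j) = M * W j - W j * M) \<longrightarrow>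
     V \<in> carrier_mat n n \<longrightarrow> (\<forall>j. mtrace (W j * V) = 0) \<longrightarrow> mtrace (W 0 * (Y * V - V * Y)) = 0)"

text \<open>Cyclicity of the trace makes commutation with \<open>M\<close> skew-adjoint for the
  trace form. Through \<open>RM_mu\<close> this also yields the invariance of the Killing
  form.\<close>

lemma mtrace_mult_commutator:
  fixes M W V :: "'a::comm_ring_1 mat"
  assumes [simp]: "M \<in> carrier_mat n n" "W \<in> carrier_mat n n" "V \<in> carrier_mat n n"
  shows "mtrace ((M * W - W * M) * V) = mtrace (W * (V * M - M * V))"
proof -
  have [simp]: "A * B \<in> carrier_mat n n" if "A \<in> carrier_mat n n" "B \<in> carrier_mat n n"
    for A B :: "'a mat" using that by (rule mult_carrier_mat)
  have "mtrace ((M * W - W * M) * V) = mtrace (M * (W * V)) - mtrace (W * (M * V))"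
    by (simp add: minus_mult_distrib_mat[of _ n n _ _ n] mtrace_diff[of _ n]
        assoc_mult_mat[of _ n n _ n _ n])
  also have "mtrace (M * (W * V)) = mtrace (W * (V * M))"
    by (subst mtrace_comm[of _ n n]) (simp_all add: assoc_mult_mat[of _ n n _ n _ n])
  finally show ?thesis
    by (simp add: mult_minus_distrib_mat[of _ n n _ n] mtrace_diff[of _ n])
qed

text \<open>
  The part \<open>V\<close> of weight \<open>c\<close> is a generalised eigenvector of the commutator with \<open>J\<close>: the
  nilpotent part of the commutator moves the entries towards the upper right corner.
\<close>

lemma weight_part_shift:
  fixes J V :: "'a::comm_ring_1 mat"
  assumes J: "J \<in> carrier_mat n n" "\<And>i j. i < n \<Longrightarrow> j < i \<Longrightarrow> J $$ (i, j) = 0"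
      "\<And>i j. i < n \<Longrightarrow> j < n \<Longrightarrow> J $$ (i, j) \<noteq> 0 \<Longrightarrow> J $$ (i, i) = J $$ (j, j)"
    and W: "\<And>j. W j \<in> carrier_mat n n" "\<And>j. W (Suc j) = J * W j - W j * J"
    and V: "V \<in> carrier_mat n n" "\<And>i j. i < n \<Longrightarrow> j < n \<Longrightarrow> V $$ (i, j) \<noteq> 0 \<Longrightarrow>
      J $$ (j, j) - J $$ (i, i) = c \<and> i + s \<le> j + n"
    and "2 * n \<le> s + m"
  shows "(shift c ^^ m) (\<lambda>j. mtrace (W j * V)) = (\<lambda>_. 0)"
  using V \<open>2 * n \<le> s + m\<close>
proof (induction m arbitrary: V s)
  case 0
  \<comment> \<open>Here \<open>2 * n \<le> s\<close>, so a nonzero entry would satisfy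
    \<open>i + n \<le> j\<close>, impossible for \<open>j < n\<close>.\<close>
  have "V = 0\<^sub>m n n"
  proof (rule eq_matI)
    fix i j assume "i < dim_row (0\<^sub>m n n :: 'a mat)" "j < dim_col (0\<^sub>m n n :: 'a mat)"
    thus "V $$ (i, j) = 0\<^sub>m n n $$ (i, j)" using 0(2)[of i j] 0(3) by auto
  qed (use 0 in auto)
  thus ?case by (simp add: right_mult_zero_mat[OF W(1)] mtrace_def)
next
  case (Suc m)
  \<comment> \<open>Moving the commutator over to \<open>V\<close> by skew-adjointness turns one
    \<open>shift c\<close> into the passage from \<open>V\<close> to \<open>V'\<close>.\<close>
  define V' where "V' = V * J - J * V - c \<cdot>\<^sub>m V"
  have V': "V' \<in> carrier_mat n n" using J Suc.prems by (auto simp: V'_def)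
  have "shift c (\<lambda>j. mtrace (W j * V)) = (\<lambda>j. mtrace (W j * V'))"
  proof
    fix j
    have [simp]: "A * B \<in> carrier_mat n n" if "A \<in> carrier_mat n n" "B \<in> carrier_mat n n"
      for A B :: "'a mat" using that by (rule mult_carrier_mat)
    show "shift c (\<lambda>j. mtrace (W j * V)) j = mtrace (W j * V')"
      using J(1) W(1)[of j] Suc.prems(1)
      by (simp add: shift_def W(2) V'_def mtrace_mult_commutator[of _ n] minus_carrier_mat
        mult_minus_distrib_mat[of _ n n _ n] mtrace_diff[of _ n] mult_smult_distrib[of _ n n _ n] mtrace_smult[of _ n])
  qed
  moreover have "(shift c ^^ m) (\<lambda>j. mtrace (W j * V')) = (\<lambda>_. 0)"
  proof (rule Suc.IH[OF V', of "Suc s"])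
    fix i j assume ij: "i < n" "j < n" "V' $$ (i, j) \<noteq> 0"
    have entry: "V' $$ (i, j) = (\<Sum>k<n. V $$ (i, k) * J $$ (k, j)) - (\<Sum>k<n. J $$ (i, k) * V $$ (k, j))
        - c * V $$ (i, j)"
      using ij J(1) Suc.prems(1) by (simp add: V'_def mult_mat_entry[of _ n n _ n] del: index_mult_mat(1))
    have "(\<Sum>k<n. V $$ (i, k) * J $$ (k, j)) = V $$ (i, j) * J $$ (j, j) + (\<Sum>k\<in>{..<n}-{j}. V $$ (i, k) * J $$ (k, j))"
      "(\<Sum>k<n. J $$ (i, k) * V $$ (k, j)) = J $$ (i, i) * V $$ (i, j) + (\<Sum>k\<in>{..<n}-{i}. J $$ (i, k) * V $$ (k, j))"
      using ij by (subst sum.remove[of _ j], simp_all, subst sum.remove[of _ i], simp_all)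
    \<comment> \<open>On weight \<open>c\<close> the diagonal of \<open>J\<close> contributes
      exactly \<open>c * V\<close>, so only strictly upper entries of \<open>J\<close> remain. These
      join equal diagonal entries, hence keep the weight and raise \<open>s\<close> by one.\<close>
    moreover have "V $$ (i, j) * J $$ (j, j) - J $$ (i, i) * V $$ (i, j) = c * V $$ (i, j)"
      using Suc.prems(2)[OF ij(1,2)] by (cases "V $$ (i, j) = 0") (auto simp: algebra_simps)
    ultimately have "(\<Sum>k\<in>{..<n}-{j}. V $$ (i, k) * J $$ (k, j)) - (\<Sum>k\<in>{..<n}-{i}. J $$ (i, k) * V $$ (k, j)) \<noteq> 0"
      using ij(3) unfolding entry by (simp add: algebra_simps)
    hence "(\<Sum>k\<in>{..<n}-{j}. V $$ (i, k) * J $$ (k, j)) \<noteq> 0 \<or> (\<Sum>k\<in>{..<n}-{i}. J $$ (i, k) * V $$ (k, j)) \<noteq> 0"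
      by auto
    thus "J $$ (j, j) - J $$ (i, i) = c \<and> i + Suc s \<le> j + n"
    proof
      assume "(\<Sum>k\<in>{..<n}-{j}. V $$ (i, k) * J $$ (k, j)) \<noteq> 0"
      then obtain k where k: "k < n" "k \<noteq> j" "V $$ (i, k) * J $$ (k, j) \<noteq> 0"
        by (auto elim!: sum.not_neutral_contains_not_neutral)
      moreover from k(3) have nz: "V $$ (i, k) \<noteq> 0" "J $$ (k, j) \<noteq> 0" by auto
      moreover from this k have "k < j" using J(2)[of k j] by fastforce
      ultimately show ?thesis using Suc.prems(2)[of i k] J(3)[of k j] ij by auto
    next
      assume "(\<Sum>k\<in>{..<n}-{i}. J $$ (i, k) * V $$ (k, j)) \<noteq> 0"
      then obtain k where k: "k < n" "k \<noteq> i" "J $$ (i, k) * V $$ (k, j) \<noteq> 0"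
        by (auto elim!: sum.not_neutral_contains_not_neutral)
      moreover from k(3) have nz: "J $$ (i, k) \<noteq> 0" "V $$ (k, j) \<noteq> 0" by auto
      moreover from this k have "i < k" using J(2)[of i k] ij by fastforce
      ultimately show ?thesis using Suc.prems(2)[of k j] J(3)[of i k] ij by auto
    qed
  qed (use Suc.prems in simp)
  ultimately show ?case by (simp only: funpow_Suc_right o_apply)
qed

text \<open>Split \<open>V\<close> by weight, the difference of two diagonal entries. The trace
  sequences of the parts are generalised eigensequences for distinct weights and add up to zero, so
  each vanishes. Commutation with the diagonal matrix multiplies the part of weight \<open>c\<close>
  by \<open>- f c\<close>, so the required trace is a combination of zeros.\<close>

lemma replica_diagonal:
  fixes J :: "'a::idom mat" and f :: "'a \<Rightarrow> 'a"
  assumes J: "J \<in> carrier_mat n n" "\<And>i j. i < n \<Longrightarrow> j < i \<Longrightarrow> J $$ (i, j) = 0"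
      "\<And>i j. i < n \<Longrightarrow> j < n \<Longrightarrow> J $$ (i, j) \<noteq> 0 \<Longrightarrow> J $$ (i, i) = J $$ (j, j)"
    and f: "\<And>x y. f (x - y) = f x - f y"
  shows "replica n J (mat n n (\<lambda>(i, j). if i = j then f (J $$ (i, i)) else 0))"
  unfolding replica_def
proof (intro allI impI)
  fix W V
  assume W: "\<forall>j. W j \<in> carrier_mat n n \<and> W (Suc j) = J * W j - W j * J"
    and V: "V \<in> carrier_mat n n" and tr0: "\<forall>j. mtrace (W j * V) = 0"
  let ?D = "mat n n (\<lambda>(i, j). if i = j then f (J $$ (i, i)) else 0)"
  define w where "w i j = J $$ (j, j) - J $$ (i, i)" for i j
  define C where "C = (\<lambda>(i, j). w i j) ` ({..<n} \<times> {..<n})"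
  have C: "w i j \<in> C" if "i < n" "j < n" for i j using that by (auto simp: C_def)
  define P where "P c = mat n n (\<lambda>(i, j). if w i j = c then V $$ (i, j) else 0)" for c
  have P: "P c \<in> carrier_mat n n" for c by (simp add: P_def)
  have trP: "mtrace (W j * P c) = (\<Sum>i<n. \<Sum>k<n. if w k i = c then W j $$ (i, k) * V $$ (k, i) else 0)" for j c
    using W P by (subst mtrace_mult[of _ n n]) (auto simp: P_def intro!: sum.cong)
  have finC: "finite C" by (simp add: C_def)
  have sum_P: "(\<Sum>c\<in>C. g c * mtrace (W j * P c)) = (\<Sum>i<n. \<Sum>k<n. g (w k i) * (W j $$ (i, k) * V $$ (k, i)))" for g j
  proof -
    have "(\<Sum>c\<in>C. g c * mtrace (W j * P c)) =
        (\<Sum>i<n. \<Sum>k<n. \<Sum>c\<in>C. if w k i = c then g c * (W j $$ (i, k) * V $$ (k, i)) else 0)"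
      unfolding trP sum_distrib_left
      by (subst sum.swap, rule sum.cong[OF refl], subst sum.swap) (auto intro!: sum.cong)
    also have "\<dots> = (\<Sum>i<n. \<Sum>k<n. g (w k i) * (W j $$ (i, k) * V $$ (k, i)))"
      using finC C by (intro sum.cong refl) (simp add: sum.delta')
    finally show ?thesis .
  qed
  have "(\<lambda>j. mtrace (W j * P c)) = (\<lambda>_. 0)" if "c \<in> C" for c
  proof (rule generalized_eigensequences_independent[OF finC _ _ that, where m = "2 * n"])
    \<comment> \<open>At level \<open>s = 0\<close> the condition on positions is void, and
      \<open>2 * n\<close> steps exhaust the matrix.\<close>
    show "(shift c ^^ (2 * n)) (\<lambda>j. mtrace (W j * P c)) = (\<lambda>_. 0)" for c
      by (rule weight_part_shift[OF J, where s = 0]) (use W P in \<open>auto simp: P_def w_def split: if_splits\<close>)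
    show "(\<lambda>j. \<Sum>c\<in>C. mtrace (W j * P c)) = (\<lambda>_. 0)"
      using sum_P[of "\<lambda>_. 1"] tr0 W V by (simp add: mtrace_mult[of _ n n] fun_eq_iff)
  qed
  hence "(\<Sum>c\<in>C. f c * mtrace (W 0 * P c)) = 0" by (auto simp: fun_eq_iff intro!: sum.neutral)
  hence "(\<Sum>i<n. \<Sum>k<n. f (w k i) * (W 0 $$ (i, k) * V $$ (k, i))) = 0" by (simp only: sum_P)
  moreover have "mtrace (W 0 * (?D * V - V * ?D)) = - (\<Sum>i<n. \<Sum>k<n. f (w k i) * (W 0 $$ (i, k) * V $$ (k, i)))"
  proof -
    have "(?D * V - V * ?D) $$ (k, i) = - f (w k i) * V $$ (k, i)" if "i < n" "k < n" for i k
    proof -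
      have "(?D * V) $$ (k, i) = f (J $$ (k, k)) * V $$ (k, i)"
        using that V
        by (subst mult_mat_entry[of _ n n _ n], simp_all, subst sum.remove[of _ k])
          (auto intro!: sum.neutral)
      moreover have "(V * ?D) $$ (k, i) = f (J $$ (i, i)) * V $$ (k, i)"
        using that V
        by (subst mult_mat_entry[of _ n n _ n], simp_all, subst sum.remove[of _ i])
          (auto intro!: sum.neutral)
      ultimately show ?thesis using that V by (simp add: w_def f algebra_simps)
    qed
    moreover define Z where "Z = ?D * V - V * ?D"
    ultimately have Z: "Z $$ (k, i) = - f (w k i) * V $$ (k, i)" if "i < n" "k < n" for i k
      using that by blast
    have "Z \<in> carrier_mat n n" using V unfolding Z_def by (intro minus_carrier_mat mult_carrier_mat) auto
    hence "mtrace (W 0 * Z) = (\<Sum>i<n. \<Sum>k<n. W 0 $$ (i, k) * Z $$ (k, i))"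
      using W by (intro mtrace_mult) auto
    also have "\<dots> = - (\<Sum>i<n. \<Sum>k<n. f (w k i) * (W 0 $$ (i, k) * V $$ (k, i)))"
      by (simp add: Z sum_negf[symmetric] mult.left_commute)
    finally show ?thesis unfolding Z_def .
  qed
  ultimately show "mtrace (W 0 * (?D * V - V * ?D)) = 0" by simp
qed

section \<open>Replicas under conjugation\<close>

lemma mult_conj_mat:
  fixes A B P Q :: "'a::comm_ring_1 mat"
  assumes "A \<in> carrier_mat n n" "B \<in> carrier_mat n n" "P \<in> carrier_mat n n" "Q \<in> carrier_mat n n"
    and "Q * P = 1\<^sub>m n"
  shows "(P * A * Q) * (P * B * Q) = P * (A * B) * Q"
proof -
  have "(P * A * Q) * (P * B * Q) = P * A * (Q * (P * (B * Q)))"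
    using assms(1-4) by (simp add: assoc_mult_mat[of _ n n _ n _ n] mult_carrier_mat[of _ n n])
  also have "Q * (P * (B * Q)) = (Q * P) * (B * Q)"
    using assms(1-4) by (simp add: assoc_mult_mat[of _ n n _ n _ n] mult_carrier_mat[of _ n n])
  finally show ?thesis
    using assms by (simp add: assoc_mult_mat[of _ n n _ n _ n] mult_carrier_mat[of _ n n])
qed

lemma minus_conj_mat:
  fixes A B P Q :: "'a::comm_ring_1 mat"
  assumes "A \<in> carrier_mat n n" "B \<in> carrier_mat n n" "P \<in> carrier_mat n n" "Q \<in> carrier_mat n n"
  shows "P * (A - B) * Q = P * A * Q - P * B * Q"
  using assms
  by (simp add: mult_minus_distrib_mat[of _ n n _ n] minus_mult_distrib_mat[of _ n n _ _ n] mult_carrier_mat[of _ n n])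

text \<open>The notion is built from products, differences and traces. The inverse conjugation
  \<open>c\<close> preserves all three and carries test data for the conjugated pair to test data
  for \<open>M\<close> and \<open>Y\<close>.\<close>

lemma replica_conj:
  fixes M Y P Q :: "'a::comm_ring_1 mat"
  assumes M: "M \<in> carrier_mat n n" and Y: "Y \<in> carrier_mat n n"
    and PQ: "P \<in> carrier_mat n n" "Q \<in> carrier_mat n n" "P * Q = 1\<^sub>m n" "Q * P = 1\<^sub>m n"
    and rep: "replica n M Y"
  shows "replica n (P * M * Q) (P * Y * Q)"
  unfolding replica_def
proof (intro allI impI)
  have carr [simp]: "A * B \<in> carrier_mat n n" if "A \<in> carrier_mat n n" "B \<in> carrier_mat n n"
    for A B :: "'a mat" using that by (rule mult_carrier_mat)
  let ?M = "P * M * Q" and ?Y = "P * Y * Q"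
  fix W V
  assume W: "\<forall>j. W j \<in> carrier_mat n n \<and> W (Suc j) = ?M * W j - W j * ?M"
    and V: "V \<in> carrier_mat n n" and tr0: "\<forall>j. mtrace (W j * V) = 0"
  define c where "c A = Q * A * P" for A
  have c_carr: "c A \<in> carrier_mat n n" if "A \<in> carrier_mat n n" for A using that PQ by (simp add: c_def)
  have c_mult: "c A * c B = c (A * B)" if "A \<in> carrier_mat n n" "B \<in> carrier_mat n n" for A B
    unfolding c_def by (rule mult_conj_mat[OF that PQ(2,1,3)])
  have c_minus: "c (A - B) = c A - c B" if "A \<in> carrier_mat n n" "B \<in> carrier_mat n n" for A B
    unfolding c_def by (rule minus_conj_mat[OF that PQ(2,1)])
  have c_tr: "mtrace (c A) = mtrace A" if "A \<in> carrier_mat n n" for A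
    unfolding c_def by (rule mtrace_conj[OF that PQ(2,1,3)])
  have c_inv: "c (P * A * Q) = A" if "A \<in> carrier_mat n n" for A
  proof -
    have "c (P * A * Q) = (Q * P) * A * (Q * P)"
      unfolding c_def using that PQ(1,2) by (simp add: assoc_mult_mat[of _ n n _ n _ n])
    thus ?thesis using that PQ by simp
  qed
  have "mtrace (c (W 0) * (Y * c V - c V * Y)) = 0"
  proof (rule rep[unfolded replica_def, rule_format])
    show "c (W j) \<in> carrier_mat n n \<and> c (W (Suc j)) = M * c (W j) - c (W j) * M" for j
    proof -
      have Wj: "W j \<in> carrier_mat n n" and MM: "?M \<in> carrier_mat n n" using W M PQ by auto
      have "c (W (Suc j)) = c (?M * W j - W j * ?M)" using W by simp
      also have "\<dots> = c ?M * c (W j) - c (W j) * c ?M"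
        using Wj MM by (simp only: c_mult c_minus carr)
      finally show ?thesis using c_carr[OF Wj] c_inv[OF M] by simp
    qed
    show "c V \<in> carrier_mat n n" by (rule c_carr[OF V])
    show "mtrace (c (W j) * c V) = 0" for j
      using W V tr0 by (simp add: c_mult c_tr)
  qed
  moreover have YY: "?Y \<in> carrier_mat n n" using Y PQ by simp
  have "c (W 0) * (Y * c V - c V * Y) = c (W 0 * (?Y * V - V * ?Y))"
  proof -
    have "c (W 0) * (Y * c V - c V * Y) = c (W 0) * (c ?Y * c V - c V * c ?Y)"
      by (simp only: c_inv[OF Y])
    also have "c ?Y * c V - c V * c ?Y = c (?Y * V - V * ?Y)"
      using V YY by (simp only: c_mult c_minus carr)
    also have "c (W 0) * \<dots> = c (W 0 * (?Y * V - V * ?Y))"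
      using W V YY by (intro c_mult minus_carrier_mat) (auto simp del: assoc_mult_mat intro: mult_carrier_mat)
    finally show ?thesis .
  qed
  moreover have "mtrace (c (W 0 * (?Y * V - V * ?Y))) = mtrace (W 0 * (?Y * V - V * ?Y))"
    using W V Y PQ by (intro c_tr carr minus_carrier_mat) auto
  ultimately show "mtrace (W 0 * (?Y * V - V * ?Y)) = 0" by simp
qed

section \<open>Nilpotency from orthogonality to replicas\<close>

text \<open>Each factor pushes nonzero entries at least one place further from the diagonal, so in
  the \<open>n\<close>-th power no place is left.\<close>

lemma strictly_upper_triangular_pow:
  fixes J :: "'a::comm_ring_1 mat"
  assumes J: "J \<in> carrier_mat n n" "\<And>i j. i < n \<Longrightarrow> j \<le> i \<Longrightarrow> J $$ (i, j) = 0"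
  shows "J ^\<^sub>m n = 0\<^sub>m n n"
proof -
  have level: "i + m \<le> j" if "i < n" "j < n" "(J ^\<^sub>m m) $$ (i, j) \<noteq> 0" for i j m
    using that
  proof (induction m arbitrary: j)
    case 0
    thus ?case using J by (auto split: if_splits)
  next
    case (Suc m)
    have "(J ^\<^sub>m Suc m) $$ (i, j) = (\<Sum>k<n. (J ^\<^sub>m m) $$ (i, k) * J $$ (k, j))"
      using Suc.prems J(1) by (simp add: mult_mat_entry[of _ n n _ n] pow_carrier_mat del: index_mult_mat)
    with Suc.prems(3) have "(\<Sum>k<n. (J ^\<^sub>m m) $$ (i, k) * J $$ (k, j)) \<noteq> 0" by metis
    then obtain k where k: "k < n" "(J ^\<^sub>m m) $$ (i, k) * J $$ (k, j) \<noteq> 0"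
      by (auto elim!: sum.not_neutral_contains_not_neutral)
    hence "(J ^\<^sub>m m) $$ (i, k) \<noteq> 0" "J $$ (k, j) \<noteq> 0" by auto
    thus ?case using Suc.IH[of k] k(1) Suc.prems(1,2) J(2)[of k j] by force
  qed
  show ?thesis
  proof (rule eq_matI)
    fix i j assume "i < dim_row (0\<^sub>m n n :: 'a mat)" "j < dim_col (0\<^sub>m n n :: 'a mat)"
    thus "(J ^\<^sub>m n) $$ (i, j) = 0\<^sub>m n n $$ (i, j)" using level[of i j n] by auto
  qed (use J pow_carrier_mat[OF J(1), of n] in auto)
qed

text \<open>A nonzero diagonal entry of the Jordan form would be detected by a rational functional.
  Orthogonality to the replica built from it makes a sum of rational squares vanish, one of them
  nonzero.\<close>

lemma nilpotent_if_orthogonal_replicas: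
  fixes M :: "'a::{alg_closed_field, field_char_0} mat"
  assumes M: "M \<in> carrier_mat n n"
    and orth: "\<And>Y. Y \<in> carrier_mat n n \<Longrightarrow> replica n M Y \<Longrightarrow> mtrace (M * Y) = 0"
  shows "M ^\<^sub>m n = 0\<^sub>m n n"
proof -
  obtain J P Q where J: "J \<in> carrier_mat n n" and PQ: "P \<in> carrier_mat n n" "Q \<in> carrier_mat n n"
    "P * Q = 1\<^sub>m n" "Q * P = 1\<^sub>m n" and M_eq: "M = P * J * Q"
    and ut: "\<And>i j. i < n \<Longrightarrow> j < i \<Longrightarrow> J $$ (i, j) = 0"
    and blk: "\<And>i j. i < n \<Longrightarrow> j < n \<Longrightarrow> J $$ (i, j) \<noteq> 0 \<Longrightarrow> J $$ (i, i) = J $$ (j, j)"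
    by (rule similar_block_upper_triangular[OF M]) (rule that)
  have diag0: "J $$ (p, p) = 0" if p: "p < n" for p
  proof (rule ccontr)
    assume "J $$ (p, p) \<noteq> 0"
    then obtain f :: "'a \<Rightarrow> rat" where f: "\<And>x y. f (x + y) = f x + f y"
      "\<And>r x. f (of_rat r * x) = r * f x" "f (J $$ (p, p)) \<noteq> 0"
      using exists_rational_functional by metis
    \<comment> \<open>\<open>g\<close> embeds the values of \<open>f\<close> back into the field, so
      that \<open>D\<close> is a matrix over it.\<close>
    define g :: "'a \<Rightarrow> 'a" where "g x = of_rat (f x)" for x
    have f_diff: "f (x - y) = f x - f y" for x y using f(1)[of "x - y" y] by simp
    have f0: "f 0 = 0" using f(1)[of 0 0] by simp
    have f_sum: "f (sum h A) = (\<Sum>a\<in>A. f (h a))" for h and A :: "nat set"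
      by (induction A rule: infinite_finite_induct) (simp_all add: f f0)
    define D where "D = mat n n (\<lambda>(i, j). if i = j then g (J $$ (i, i)) else 0)"
    have D: "D \<in> carrier_mat n n" by (simp add: D_def)
    have "replica n J D" unfolding D_def
      by (rule replica_diagonal[OF J ut blk]) (simp_all add: g_def f_diff of_rat_diff)
    hence "replica n M (P * D * Q)" unfolding M_eq by (rule replica_conj[OF J D PQ])
    hence "mtrace (M * (P * D * Q)) = 0" using orth D PQ by (simp add: mult_carrier_mat[of _ n n])
    hence "0 = mtrace (J * D)"
      unfolding M_eq mult_conj_mat[OF J D PQ(1,2,4)]
      using mtrace_conj[OF mult_carrier_mat[OF J D] PQ(1,2,4)] by simp
    also have "\<dots> = (\<Sum>i<n. g (J $$ (i, i)) * J $$ (i, i))"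
    proof -
      have "(\<Sum>k<n. J $$ (i, k) * D $$ (k, i)) = g (J $$ (i, i)) * J $$ (i, i)" if "i < n" for i
        by (subst sum.remove[of _ i]) (use that in \<open>auto simp: D_def intro!: sum.neutral\<close>)
      thus ?thesis by (simp add: mtrace_mult[OF J D])
    qed
    finally have "f 0 = f (\<Sum>i<n. g (J $$ (i, i)) * J $$ (i, i))" by simp
    \<comment> \<open>The values of \<open>g\<close> are rational scalars and leave \<open>f\<close>
      by linearity; in the rationals squares are nonnegative.\<close>
    hence "(\<Sum>i<n. f (J $$ (i, i)) * f (J $$ (i, i))) = 0" by (simp add: f0 f_sum g_def f(2))
    hence "f (J $$ (p, p)) * f (J $$ (p, p)) = 0"
      using p by (subst (asm) sum_nonneg_eq_0_iff) auto
    thus False using f(3) by simp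
  qed
  have "J ^\<^sub>m n = 0\<^sub>m n n"
    by (rule strictly_upper_triangular_pow[OF J]) (metis diag0 ut le_neq_implies_less)
  moreover have "similar_mat_wit M J P Q"
    by (rule similar_mat_witI[OF PQ(3,4) M_eq M J PQ(1,2)])
  ultimately show ?thesis using similar_mat_wit_pow_id[of M J P Q n] PQ by simp
qed

lemma mtrace_map_to_ac: "A \<in> carrier_mat n n \<Longrightarrow> mtrace (map_mat to_ac A) = to_ac (mtrace A)"
  by (auto simp: mtrace_def to_ac_sum)

section \<open>Matrices of endomorphisms\<close>

locale based_vector_space = vector_space scale
  for scale :: "'k::field \<Rightarrow> 'v::ab_group_add \<Rightarrow> 'v" +
  fixes n :: nat and e :: "nat \<Rightarrow> 'v"
  assumes basis: "indexed_basis scale n e"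
begin

abbreviation "endo \<equiv> Vector_Spaces.linear scale scale"

lemma basis_facts: "inj_on e {..<n}" "independent (e ` {..<n})" "span (e ` {..<n}) = UNIV"
  using basis by (auto simp: indexed_basis_def)

sublocale finite_dimensional_vector_space scale "e ` {..<n}"
  by unfold_locales (use basis_facts in auto)

definition coord :: "'v \<Rightarrow> nat \<Rightarrow> 'k" where
  "coord v i = representation (e ` {..<n}) v (e i)"

lemma coord_add: "coord (v + w) i = coord v i + coord w i"
  and coord_diff: "coord (v - w) i = coord v i - coord w i"
  and coord_scale: "coord (scale c v) i = c * coord v i"
  and coord_sum: "coord (\<Sum>a\<in>A. f a) i = (\<Sum>a\<in>A. coord (f a) i)"
  using basis_facts
  by (simp_all add: coord_def representation_add representation_diff representation_scale representation_sum)

lemma coord_expansion: "(\<Sum>i<n. scale (coord v i) (e i)) = v"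
proof -
  have "(\<Sum>i<n. scale (coord v i) (e i)) = (\<Sum>b\<in>e ` {..<n}. scale (representation (e ` {..<n}) v b) b)"
    by (simp add: sum.reindex[OF basis_facts(1)] coord_def)
  also have "\<dots> = v" using basis_facts by (intro sum_representation_eq) auto
  finally show ?thesis .
qed

lemma coord_basis: "i < n \<Longrightarrow> j < n \<Longrightarrow> coord (e j) i = (if i = j then 1 else 0)"
  using basis_facts by (auto simp: coord_def representation_basis dest: inj_onD)

lemma coord_eq_0D: "(\<And>i. i < n \<Longrightarrow> coord v i = 0) \<Longrightarrow> v = 0"
  using coord_expansion[of v] by simp

lemma endo_expansion:
  assumes "endo f"
  shows "f v = (\<Sum>i<n. scale (coord v i) (f (e i)))"
proof -
  interpret f: Vector_Spaces.linear scale scale f by (rule assms)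
  have "f v = f (\<Sum>i<n. scale (coord v i) (e i))" by (simp add: coord_expansion)
  thus ?thesis by (simp add: f.sum f.scale)
qed

definition mat_of :: "('v \<Rightarrow> 'v) \<Rightarrow> 'k mat" where
  "mat_of f = mat n n (\<lambda>(i, j). coord (f (e j)) i)"

lemma mat_of_carrier [simp]: "mat_of f \<in> carrier_mat n n"
  by (simp add: mat_of_def)

lemma mat_of_comp:
  assumes "endo f"
  shows "mat_of (f \<circ> g) = mat_of f * mat_of g"
proof (rule eq_matI)
  fix i j assume "i < dim_row (mat_of f * mat_of g)" "j < dim_col (mat_of f * mat_of g)"
  hence ij: "i < n" "j < n" by (simp_all add: mat_of_def)
  have "coord (f (g (e j))) i = (\<Sum>k<n. coord (g (e j)) k * coord (f (e k)) i)"
    by (subst endo_expansion[OF assms]) (simp add: coord_sum coord_scale)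
  also have "\<dots> = (mat_of f * mat_of g) $$ (i, j)"
    unfolding mult_mat_entry[OF mat_of_carrier mat_of_carrier ij]
    using ij by (auto simp: mat_of_def mult.commute intro!: sum.cong)
  finally show "mat_of (f \<circ> g) $$ (i, j) = (mat_of f * mat_of g) $$ (i, j)"
    using ij by (simp add: mat_of_def)
qed (simp_all add: mat_of_def)

text \<open>Linearity of the power is carried through the induction because
  \<open>mat_of_comp\<close> asks for it of the outer map.\<close>

lemma mat_of_funpow:
  assumes "endo f"
  shows "mat_of (f ^^ k) = mat_of f ^\<^sub>m k \<and> endo (f ^^ k)"
proof (induction k)
  case 0
  show ?case by (auto simp: mat_of_def coord_basis linear_id[unfolded id_def] id_def intro!: eq_matI)
next
  case (Suc k)
  thus ?case unfolding funpow_Suc_right pow_mat.simps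
    using mat_of_comp[of "f ^^ k" f] Vector_Spaces.linear_compose[OF assms, of scale "f ^^ k"] by metis
qed

lemma mat_of_eq_0D:
  assumes "endo f" "mat_of f = 0\<^sub>m n n"
  shows "f v = 0"
proof -
  have "f (e j) = 0" if "j < n" for j
  proof (rule coord_eq_0D)
    fix i assume "i < n"
    hence "mat_of f $$ (i, j) = 0" using assms(2) that by simp
    thus "coord (f (e j)) i = 0" using \<open>i < n\<close> that by (simp add: mat_of_def)
  qed
  thus ?thesis by (subst endo_expansion[OF assms(1)]) simp
qed

lemma endo_trace_eq_mtrace:
  assumes "endo f"
  shows "endo_trace scale f = mtrace (mat_of f)"
  using endo_trace_eq[OF assms, of "e ` {..<n}"] basis_facts
  by (simp add: sum.reindex mtrace_def mat_of_def coord_def)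

text \<open>In a basis \<open>C\<close> extending a basis \<open>A\<close> of the kernel,
  \<open>f\<close> kills \<open>A\<close> and maps everything into the span of \<open>A\<close>, so
  all diagonal coefficients are zero.\<close>

lemma endo_trace_square_zero:
  assumes f: "endo f" and sq: "\<And>v. f (f v) = 0"
  shows "endo_trace scale f = 0"
proof -
  interpret f: Vector_Spaces.linear scale scale f by (rule f)
  have "subspace {v. f v = 0}"
    by (auto simp: subspace_def f.add f.scale f.zero)
  then obtain A where A: "A \<subseteq> {v. f v = 0}" "independent A" "{v. f v = 0} \<subseteq> span A"
    using basis_exists by metis
  define C where "C = extend_basis A"
  have C: "A \<subseteq> C" "independent C" "span C = UNIV"
    using extend_basis_superset[OF A(2)] independent_extend_basis[OF A(2)] span_extend_basis[OF A(2)]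
    by (auto simp: C_def)
  have "representation C (f c) c = 0" if "c \<in> C" for c
  proof (cases "c \<in> A")
    case True
    thus ?thesis using A(1) by (auto simp: representation_zero)
  next
    case False
    have "representation C (f c) = representation A (f c)"
      using C A(3) sq by (intro representation_extend) auto
    thus ?thesis using False representation_ne_zero[of A "f c" c] by auto
  qed
  moreover have "finite C" using finiteI_independent[OF C(2)] .
  ultimately show ?thesis using endo_trace_eq[OF f _ C(2,3)] by simp
qed

text \<open>Dimensions are bounded, so a maximum is attained. Maximal choices replace inductions on
  dimension around Engel's theorem.\<close>

lemma obtain_max_dim:
  assumes "P S"
  obtains T where "P T" "\<And>T'. P T' \<Longrightarrow> dim T' \<le> dim T"
proof -
  have "\<forall>T. P T \<longrightarrow> dim T < Suc dimension" using dim_subset_UNIV by (simp add: less_Suc_eq_le)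
  from ex_has_greatest_nat[of P S dim, OF assms this] show ?thesis using that by blast
qed

end

section \<open>The Killing form\<close>

locale leibniz_algebra = based_vector_space +
  fixes \<mu> :: "'b \<Rightarrow> 'b \<Rightarrow> 'b"
  assumes leib: "\<mu> \<in> Leib scale"
begin

lemma bilinear: "endo (\<lambda>b. \<mu> a b)" "endo (\<lambda>a. \<mu> a b)"
  using leib by (auto simp: Leib_def bilinear_product_def)

lemma leibniz: "\<mu> (\<mu> a b) c = \<mu> (\<mu> a c) b + \<mu> a (\<mu> b c)"
  using leib unfolding Leib_def by blast

lemma mu_simps:
  "\<mu> (a + b) c = \<mu> a c + \<mu> b c" "\<mu> a (b + c) = \<mu> a b + \<mu> a c"
  "\<mu> (a - b) c = \<mu> a c - \<mu> b c" "\<mu> a (b - c) = \<mu> a b - \<mu> a c"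
  "\<mu> (- a) c = - \<mu> a c" "\<mu> a (- c) = - \<mu> a c"
  "\<mu> (scale r a) c = scale r (\<mu> a c)" "\<mu> a (scale r c) = scale r (\<mu> a c)"
  "\<mu> 0 c = 0" "\<mu> a 0 = 0"
proof -
  interpret l: Vector_Spaces.linear scale scale "\<lambda>b. \<mu> a b" by (rule bilinear)
  interpret r: Vector_Spaces.linear scale scale "\<lambda>a. \<mu> a c" by (rule bilinear)
  show "\<mu> (a + b) c = \<mu> a c + \<mu> b c" "\<mu> a (b + c) = \<mu> a b + \<mu> a c"
    "\<mu> (a - b) c = \<mu> a c - \<mu> b c" "\<mu> a (b - c) = \<mu> a b - \<mu> a c"
    "\<mu> (- a) c = - \<mu> a c" "\<mu> a (- c) = - \<mu> a c"
    "\<mu> (scale r a) c = scale r (\<mu> a c)" "\<mu> a (scale r c) = scale r (\<mu> a c)"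
    "\<mu> 0 c = 0" "\<mu> a 0 = 0"
    by (fact r.add l.add r.diff l.diff r.neg l.neg r.scale l.scale r.zero l.zero)+
qed

abbreviation "R \<equiv> right_mult \<mu>"
abbreviation "\<kappa> \<equiv> killing_form scale \<mu>"

definition RM :: "'b \<Rightarrow> 'a mat" where "RM a = mat_of (R a)"

lemma RM_carrier [simp]: "RM a \<in> carrier_mat n n"
  by (simp add: RM_def)

lemma RM_dim [simp]: "dim_row (RM a) = n" "dim_col (RM a) = n"
  by (simp_all add: RM_def mat_of_def)

lemma endo_R: "endo (R a)"
  unfolding right_mult_def by (rule bilinear)

lemma RM_add: "RM (a + b) = RM a + RM b"
  and RM_scale: "RM (scale c a) = c \<cdot>\<^sub>m RM a"
  by (auto simp: RM_def mat_of_def right_mult_def mu_simps coord_add coord_scale)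

lemma RM_zero: "RM 0 = 0\<^sub>m n n"
  using coord_scale[of 0 0] by (auto simp: RM_def mat_of_def right_mult_def mu_simps)

lemma RM_mu: "RM (\<mu> a b) = RM b * RM a - RM a * RM b"
proof -
  have "RM b * RM a - RM a * RM b = mat_of (R b \<circ> R a) - mat_of (R a \<circ> R b)"
    by (simp add: RM_def mat_of_comp endo_R)
  also have "\<dots> = mat_of (R (\<mu> a b))"
    by (auto simp: mat_of_def right_mult_def coord_diff[symmetric] leibniz[of _ a b])
  finally show ?thesis by (simp add: RM_def)
qed

lemma killing_form_RM: "\<kappa> a b = mtrace (RM a * RM b)"
  unfolding killing_form_def RM_def
  by (simp add: endo_trace_eq_mtrace Vector_Spaces.linear_compose[OF endo_R endo_R] mat_of_comp endo_R)

lemma killing_form_sym: "\<kappa> a b = \<kappa> b a"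
  unfolding killing_form_RM by (rule mtrace_comm[of _ n n]) auto

lemma killing_form_add: "\<kappa> (a + b) c = \<kappa> a c + \<kappa> b c"
  by (simp add: killing_form_RM RM_add add_mult_distrib_mat[of _ n n _ _ n] mtrace_add[of _ n] mult_carrier_mat[of _ n n])

lemma killing_form_scale: "\<kappa> (scale r a) c = r * \<kappa> a c"
  by (simp add: killing_form_RM RM_scale mult_smult_assoc_mat[of _ n n _ n] mtrace_smult[of _ n] mult_carrier_mat[of _ n n])

lemma killing_form_zero: "\<kappa> 0 c = 0"
  using killing_form_scale[of 0 0 c] by simp

text \<open>Invariance is what makes the radical of the form an ideal.\<close>

lemma killing_form_invariant: "\<kappa> (\<mu> a b) c = \<kappa> a (\<mu> b c)"
  unfolding killing_form_RM RM_mu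
  by (rule mtrace_mult_commutator[of _ n]) simp_all

lemma killing_form_sum_right: "\<kappa> a (\<Sum>i\<in>A. scale (r i) (f i)) = (\<Sum>i\<in>A. r i * \<kappa> a (f i))"
  unfolding killing_form_sym[of a]
  by (induction A rule: infinite_finite_induct) (simp_all add: killing_form_add killing_form_scale killing_form_zero)

lemma nondegenerate_killing_form_iff: "nondegenerate \<kappa> \<longleftrightarrow> (\<forall>a. (\<forall>b. \<kappa> a b = 0) \<longrightarrow> a = 0)"
  unfolding nondegenerate_def by (metis killing_form_sym)

section \<open>The Gram determinant\<close>

text \<open>Coordinates identify the kernel of the Gram matrix with the radical of the form.\<close>

lemma det_gram_matrix_eq_0_iff:
  "det (gram_matrix n e \<kappa>) = 0 \<longleftrightarrow> \<not> nondegenerate \<kappa>"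
proof -
  let ?G = "gram_matrix n e \<kappa>"
  have G: "?G \<in> carrier_mat n n" by (simp add: gram_matrix_def)
  have Gv: "(?G *\<^sub>v v) $ i = \<kappa> (e i) (\<Sum>j<n. scale (v $ j) (e j))"
    if "v \<in> carrier_vec n" "i < n" for v i
    using that by (auto simp: gram_matrix_def scalar_prod_def killing_form_sum_right
        lessThan_atLeast0 mult.commute intro!: sum.cong)
  have all: "(\<forall>b. \<kappa> a b = 0) \<longleftrightarrow> (\<forall>i<n. \<kappa> (e i) a = 0)" for a
  proof
    assume e0: "\<forall>i<n. \<kappa> (e i) a = 0"
    show "\<forall>b. \<kappa> a b = 0"
    proof
      fix b
      have "\<kappa> a b = \<kappa> a (\<Sum>i<n. scale (coord b i) (e i))" by (simp add: coord_expansion)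
      thus "\<kappa> a b = 0" unfolding killing_form_sum_right using e0 killing_form_sym[of a] by simp
    qed
  qed (use killing_form_sym in metis)
  show ?thesis
  proof
    assume "det ?G = 0"
    then obtain v where v: "v \<in> carrier_vec n" "v \<noteq> 0\<^sub>v n" "?G *\<^sub>v v = 0\<^sub>v n"
      using det_0_iff_vec_prod_zero_field[OF G] by blast
    define a where "a = (\<Sum>j<n. scale (v $ j) (e j))"
    have "coord a i = v $ i" if "i < n" for i
    proof -
      have "coord a i = (\<Sum>j<n. if i = j then v $ j else 0)"
        unfolding a_def coord_sum coord_scale using that by (intro sum.cong) (auto simp: coord_basis)
      thus ?thesis using that by simp
    qed
    moreover obtain i where "i < n" "v $ i \<noteq> 0"
      using v by (metis carrier_vecD eq_vecI index_zero_vec(1) index_zero_vec(2))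
    ultimately have "a \<noteq> 0" using coord_scale[of 0 0 i] by auto
    moreover have "\<kappa> (e i) a = 0" if "i < n" for i
      using Gv[OF v(1) that] v(3) that by (simp add: a_def)
    ultimately show "\<not> nondegenerate \<kappa>" unfolding nondegenerate_killing_form_iff using all by blast
  next
    assume "\<not> nondegenerate \<kappa>"
    then obtain a where a: "a \<noteq> 0" "\<forall>b. \<kappa> a b = 0" unfolding nondegenerate_killing_form_iff by blast
    define v where "v = vec n (coord a)"
    have v: "v \<in> carrier_vec n" by (simp add: v_def)
    moreover have "v \<noteq> 0\<^sub>v n"
    proof
      assume v0: "v = 0\<^sub>v n"
      have "a = 0" by (rule coord_eq_0D) (metis index_vec index_zero_vec(1) v0 v_def)
      thus False using a by simp
    qed
    moreover have "(\<Sum>j<n. scale (v $ j) (e j)) = a"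
      using coord_expansion[of a] by (simp add: v_def)
    hence "?G *\<^sub>v v = 0\<^sub>v n"
      using Gv[OF v] all[of a] a(2) G by (intro eq_vecI) auto
    ultimately show "det ?G = 0" using det_0_iff_vec_prod_zero_field[OF G] by blast
  qed
qed

section \<open>From a nondegenerate Killing form to a semisimple Lie algebra\<close>

text \<open>By \<open>RM_mu\<close> the matrix of \<open>R (\<mu> a a)\<close> is a commutator of a
  matrix with itself, so \<open>\<mu> a a\<close> lies in the radical.\<close>

lemma nondegenerate_imp_alternating:
  assumes "nondegenerate \<kappa>"
  shows "\<mu> a a = 0"
proof -
  have "RM (\<mu> a a) = 0\<^sub>m n n" unfolding RM_mu
    using mult_carrier_mat[OF RM_carrier RM_carrier] by (intro minus_r_inv_mat)
  hence "\<kappa> (\<mu> a a) b = 0" for b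
    by (simp add: killing_form_RM left_mult_zero_mat[of _ n n] mtrace_def)
  thus ?thesis using assms unfolding nondegenerate_killing_form_iff by blast
qed

lemma alternating_imp_anticommute:
  assumes "\<And>a. \<mu> a a = 0"
  shows "\<mu> a b = - \<mu> b a"
  using assms[of "a + b"] assms[of a] assms[of b] by (simp add: mu_simps eq_neg_iff_add_eq_0 add.commute)

text \<open>Under anticommutativity the Leibniz identity rearranges to the Jacobi identity.\<close>

lemma alternating_imp_lie_algebra:
  assumes "\<And>a. \<mu> a a = 0"
  shows "lie_algebra scale \<mu>"
proof -
  note anti = alternating_imp_anticommute[OF assms]
  have "\<mu> a (\<mu> b c) + \<mu> b (\<mu> c a) + \<mu> c (\<mu> a b) = 0" for a b c
  proof -
    have "- \<mu> c (\<mu> a b) = \<mu> (\<mu> a b) c" using anti by metis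
    also have "\<dots> = \<mu> (\<mu> a c) b + \<mu> a (\<mu> b c)" by (rule leibniz)
    also have "\<mu> (\<mu> a c) b = \<mu> b (\<mu> c a)" using anti[of "\<mu> a c" b] anti[of a c] by (simp add: mu_simps)
    finally show ?thesis by (simp add: algebra_simps eq_neg_iff_add_eq_0 neg_eq_iff_add_eq_0)
  qed
  thus ?thesis using bilinear assms by (simp add: lie_algebra_def bilinear_product_def)
qed

end

locale alternating_leibniz_algebra = leibniz_algebra +
  assumes alternating: "\<mu> a a = 0"
begin

lemmas anticommute = alternating_imp_anticommute[OF alternating]

lemma algebra_idealI:
  assumes "subspace S" "\<And>a b. a \<in> S \<Longrightarrow> \<mu> a b \<in> S"
  shows "algebra_ideal scale \<mu> S"
proof -
  have "\<mu> a b \<in> S" if "b \<in> S" for a b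
    using subspace_neg[OF assms(1) assms(2)[OF that]] anticommute[of a b] by simp
  thus ?thesis using assms by (simp add: algebra_ideal_def)
qed

text \<open>The Leibniz identity distributes an outer factor over a product of two elements of the
  previous term, which is an ideal and so absorbs it.\<close>

lemma algebra_ideal_derived_series:
  assumes "algebra_ideal scale \<mu> I"
  shows "algebra_ideal scale \<mu> (derived_series scale \<mu> I k)"
proof (induction k)
  case 0
  show ?case using assms by simp
next
  case (Suc k)
  let ?D = "derived_series scale \<mu> I k"
  let ?S = "{\<mu> a b | a b. a \<in> ?D \<and> b \<in> ?D}"
  have "\<mu> x c \<in> span ?S" if "x \<in> span ?S" for x c
    using that
  proof (induction rule: span_induct_alt)
    case base
    show ?case by (simp add: mu_simps span_zero)
  next
    case (step r x y)
    then obtain a b where ab: "x = \<mu> a b" "a \<in> ?D" "b \<in> ?D" by blast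
    have "\<mu> a c \<in> ?D" "\<mu> b c \<in> ?D" using Suc ab by (auto simp: algebra_ideal_def)
    hence "\<mu> (\<mu> a c) b \<in> span ?S" "\<mu> a (\<mu> b c) \<in> span ?S" using ab by (auto intro!: span_base)
    hence "\<mu> x c \<in> span ?S" unfolding ab(1) leibniz[of a b c] by (rule span_add)
    thus ?case using step by (simp add: mu_simps span_add span_scale)
  qed
  thus ?case by (auto intro: algebra_idealI)
qed

lemma derived_series_Suc_subset:
  assumes "algebra_ideal scale \<mu> I"
  shows "derived_series scale \<mu> I (Suc k) \<subseteq> derived_series scale \<mu> I k"
  unfolding derived_series.simps
  by (rule span_minimal) (use algebra_ideal_derived_series[OF assms, of k] in \<open>auto simp: algebra_ideal_def\<close>)

text \<open>\<open>R a\<close> maps everything into \<open>A\<close>, \<open>R b\<close> keeps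
  \<open>A\<close> stable, and \<open>R a\<close> kills \<open>A\<close>; hence
  \<open>R a \<circ> R b\<close> has square zero.\<close>

lemma abelian_ideal_killing_form:
  assumes "algebra_ideal scale \<mu> A" "\<And>a b. a \<in> A \<Longrightarrow> b \<in> A \<Longrightarrow> \<mu> a b = 0" "a \<in> A"
  shows "\<kappa> a b = 0"
  unfolding killing_form_def
proof (rule endo_trace_square_zero)
  show "endo (R a \<circ> R b)" by (rule Vector_Spaces.linear_compose[OF endo_R endo_R])
  have "\<mu> (\<mu> v b) a \<in> A" for v using assms by (auto simp: algebra_ideal_def)
  hence "\<mu> (\<mu> (\<mu> v b) a) b \<in> A" for v using assms by (auto simp: algebra_ideal_def)
  thus "(R a \<circ> R b) ((R a \<circ> R b) v) = 0" for v using assms(2,3) by (simp add: right_mult_def)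
qed

text \<open>The last nonzero term of the derived series is an abelian ideal, hence lies in the
  radical of the form.\<close>

lemma nondegenerate_imp_no_solvable_ideal:
  assumes "nondegenerate \<kappa>" "algebra_ideal scale \<mu> I" "solvable_subalgebra scale \<mu> I"
  shows "I = {0}"
proof (rule ccontr)
  assume "I \<noteq> {0}"
  define D where "D = derived_series scale \<mu> I"
  define k where "k = (LEAST k. D k = {0})"
  have Dk: "D k = {0}" using assms(3) unfolding k_def solvable_subalgebra_def D_def by (rule LeastI_ex)
  have "D 0 \<noteq> {0}" using \<open>I \<noteq> {0}\<close> by (simp add: D_def)
  hence "k \<noteq> 0" using Dk by metis
  then obtain m where m: "k = Suc m" by (cases k) auto
  have "D m \<noteq> {0}" using not_less_Least[of m "\<lambda>k. D k = {0}"] m unfolding k_def by auto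
  moreover have id: "algebra_ideal scale \<mu> (D m)" unfolding D_def by (rule algebra_ideal_derived_series[OF assms(2)])
  hence "0 \<in> D m" by (auto simp: algebra_ideal_def subspace_0)
  ultimately obtain a where a: "a \<in> D m" "a \<noteq> 0" by blast
  have "\<mu> a b = 0" if "a \<in> D m" "b \<in> D m" for a b
  proof -
    have "\<mu> a b \<in> D (Suc m)" using that by (auto simp: D_def intro!: span_base)
    thus ?thesis using Dk m by simp
  qed
  hence "\<kappa> a b = 0" for b using abelian_ideal_killing_form[OF id _ a(1)] by blast
  thus False using assms(1) a(2) unfolding nondegenerate_killing_form_iff by blast
qed

section \<open>Engel's theorem\<close>

text \<open>
  For a subalgebra \<open>H\<close> this is Engel's theorem for all subquotients \<open>B/A\<close> of \<open>V\<close> as \<open>H\<close>-module.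
\<close>

definition engel :: "'b set \<Rightarrow> bool" where
  "engel H \<longleftrightarrow> (\<forall>A B. subspace A \<longrightarrow> subspace B \<longrightarrow> A \<subset> B \<longrightarrow>
     (\<forall>a\<in>A. \<forall>h\<in>H. \<mu> a h \<in> A) \<longrightarrow> (\<forall>b\<in>B. \<forall>h\<in>H. \<mu> b h \<in> B) \<longrightarrow>
     (\<exists>b\<in>B - A. \<forall>h\<in>H. \<mu> b h \<in> A))"

lemma engelE:
  assumes "engel H" "subspace A" "subspace B" "A \<subset> B"
    and "\<And>a h. a \<in> A \<Longrightarrow> h \<in> H \<Longrightarrow> \<mu> a h \<in> A" "\<And>b h. b \<in> B \<Longrightarrow> h \<in> H \<Longrightarrow> \<mu> b h \<in> B"
  obtains b where "b \<in> B" "b \<notin> A" "\<And>h. h \<in> H \<Longrightarrow> \<mu> b h \<in> A"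
proof -
  have "\<exists>b\<in>B - A. \<forall>h\<in>H. \<mu> b h \<in> A"
    by (rule assms(1)[unfolded engel_def, rule_format, OF assms(2-4)]) (fact assms(5,6))+
  thus ?thesis using that by blast
qed

text \<open>\<open>H\<close> sends some vector of \<open>B\<close> outside \<open>A\<close> into
  \<open>A\<close>. Since \<open>z\<close> normalises \<open>H\<close>, the set \<open>C\<close> of
  vectors so treated is stable under \<open>R z\<close>, and nilpotency of \<open>R z\<close> lets
  one choose such a vector that \<open>z\<close> sends into \<open>A\<close> as well.\<close>

lemma engel_insert:
  assumes H: "subspace H" "engel H" and z: "\<And>h. h \<in> H \<Longrightarrow> \<mu> z h \<in> H" and nil: "\<And>v. (R z ^^ m) v = 0"
  shows "engel (span (insert z H))"
  unfolding engel_def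
proof (intro allI impI)
  fix A B
  assume A: "subspace A" and B: "subspace B" and AB: "A \<subset> B"
    and stA: "\<forall>a\<in>A. \<forall>h\<in>span (insert z H). \<mu> a h \<in> A"
    and stB: "\<forall>b\<in>B. \<forall>h\<in>span (insert z H). \<mu> b h \<in> B"
  have sub: "z \<in> span (insert z H)" "H \<subseteq> span (insert z H)" by (auto intro: span_base)
  define C where "C = {b \<in> B. \<forall>h\<in>H. \<mu> b h \<in> A}"
  obtain c where "c \<in> B" and c: "c \<notin> A" and "\<And>h. h \<in> H \<Longrightarrow> \<mu> c h \<in> A"
    by (rule engelE[OF H(2) A B AB]) (use stA stB sub in blast)+
  hence c: "c \<in> C" "c \<notin> A" unfolding C_def by blast+
  have C_z: "\<mu> b z \<in> C" if "b \<in> C" for b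
  proof -
    have "\<mu> (\<mu> b z) h \<in> A" if "h \<in> H" for h
      unfolding leibniz[of b z h]
      using that \<open>b \<in> C\<close> z stA sub by (intro subspace_add[OF A]) (auto simp: C_def)
    thus ?thesis using that stB sub by (auto simp: C_def)
  qed
  have pow: "(R z ^^ j) c \<in> C" for j
    by (induction j) (use c C_z in \<open>auto simp: right_mult_def\<close>)
  \<comment> \<open>The vector wanted is the last iterate of \<open>c\<close> outside
    \<open>A\<close>. As \<open>c\<close> itself is not in \<open>A\<close>, the exponent
    \<open>j\<close> is positive and has a predecessor \<open>i\<close>.\<close>
  define j where "j = (LEAST j. (R z ^^ j) c \<in> A)"
  have "(R z ^^ m) c \<in> A" using nil A by (simp add: subspace_0)
  hence jA: "(R z ^^ j) c \<in> A" unfolding j_def by (rule LeastI)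
  have "j \<noteq> 0" using jA c by (intro notI) simp
  then obtain i where i: "j = Suc i" by (cases j) auto
  define w where "w = (R z ^^ i) c"
  have "w \<notin> A" using not_less_Least[of i "\<lambda>j. (R z ^^ j) c \<in> A"] i unfolding w_def j_def by auto
  moreover have wC: "w \<in> C" using pow by (simp add: w_def)
  moreover have wz: "\<mu> w z \<in> A" using jA by (simp add: i w_def right_mult_def)
  have "\<mu> w h \<in> A" if h: "h \<in> span (insert z H)" for h
  proof -
    obtain r where "h - scale r z \<in> span H" using h by (auto simp: span_breakdown_eq)
    hence "\<mu> w (h - scale r z) \<in> A" using wC span_eq_iff[THEN iffD2, OF H(1)] by (simp add: C_def)
    hence "\<mu> w (h - scale r z) + scale r (\<mu> w z) \<in> A"
      using wz A by (intro subspace_add subspace_scale)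
    thus ?thesis by (simp add: mu_simps)
  qed
  ultimately show "\<exists>b\<in>B - A. \<forall>h\<in>span (insert z H). \<mu> b h \<in> A" by (auto simp: C_def)
qed

text \<open>Take a subalgebra \<open>H\<close> of largest dimension in \<open>I\<close> with the
  property. If it were proper, adjoining a normalising element by \<open>engel_insert\<close> would
  enlarge it.\<close>

lemma engel_nilpotent:
  assumes I: "subspace I" "\<And>a b. a \<in> I \<Longrightarrow> b \<in> I \<Longrightarrow> \<mu> a b \<in> I"
    and nil: "\<And>x v. x \<in> I \<Longrightarrow> (R x ^^ m) v = 0"
  shows "engel I"
proof -
  define P where "P H \<longleftrightarrow> subspace H \<and> H \<subseteq> I \<and> (\<forall>a\<in>H. \<forall>b\<in>H. \<mu> a b \<in> H) \<and> engel H" for H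
  have "P {0}" using I by (auto simp: P_def engel_def mu_simps subspace_0)
  then obtain H where H: "P H" and max: "\<And>H'. P H' \<Longrightarrow> dim H' \<le> dim H"
    by (rule obtain_max_dim) (rule that)
  have "H = I"
  proof (rule ccontr)
    assume "H \<noteq> I"
    have "engel H" "subspace H" "H \<subset> I" "\<And>a h. a \<in> H \<Longrightarrow> h \<in> H \<Longrightarrow> \<mu> a h \<in> H"
        "\<And>b h. b \<in> I \<Longrightarrow> h \<in> H \<Longrightarrow> \<mu> b h \<in> I"
      using H \<open>H \<noteq> I\<close> I(2) unfolding P_def by blast+
    \<comment> \<open>Applied to \<open>H\<close> acting on the quotient of \<open>I\<close> by
      \<open>H\<close>, the property yields \<open>z\<close> outside \<open>H\<close> that
      normalises \<open>H\<close>.\<close>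
    from engelE[OF this(1,2) I(1) this(3-5)]
    obtain z where z: "z \<in> I" "z \<notin> H" "\<And>h. h \<in> H \<Longrightarrow> \<mu> z h \<in> H" by blast
    define H' where "H' = span (insert z H)"
    have sub: "H \<subset> H'" using z(2) by (auto simp: H'_def intro: span_base)
    have "P H'" unfolding P_def
    proof (intro conjI ballI)
      show "subspace H'" by (simp add: H'_def)
      show "H' \<subseteq> I" unfolding H'_def using H I(1) z(1) by (intro span_minimal) (auto simp: P_def)
      show "engel H'" unfolding H'_def by (rule engel_insert) (use H z nil in \<open>auto simp: P_def\<close>)
      fix a b assume "a \<in> H'" "b \<in> H'"
      then obtain r s where "a - scale r z \<in> span H" "b - scale s z \<in> span H"
        by (auto simp: H'_def span_breakdown_eq)
      moreover have "span H = H" using H by (simp add: P_def)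
      ultimately have rs: "a - scale r z \<in> H" "b - scale s z \<in> H" by simp_all
      define a' b' where "a' = a - scale r z" and "b' = b - scale s z"
      have ab: "a = a' + scale r z" "b = b' + scale s z" by (simp_all add: a'_def b'_def)
      have "\<mu> a' b' \<in> H" "\<mu> z b' \<in> H" "\<mu> z a' \<in> H" using rs H z unfolding a'_def b'_def P_def by auto
      \<comment> \<open>This is the expansion of \<open>\<mu> a b\<close>: the
        \<open>z\<close>-\<open>z\<close> term vanishes, and anticommutativity replaces
        \<open>\<mu> a' z\<close> by \<open>- \<mu> z a'\<close>.\<close>
      hence "\<mu> a' b' + scale r (\<mu> z b') - scale s (\<mu> z a') \<in> H"
        using H by (simp add: P_def subspace_add subspace_diff subspace_scale)
      also have "\<mu> a' b' + scale r (\<mu> z b') - scale s (\<mu> z a') = \<mu> a b"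
        unfolding ab using anticommute[of a' z] by (simp add: mu_simps alternating)
      finally show "\<mu> a b \<in> H'" using sub by blast
    qed
    moreover from this have "dim H < dim H'" using sub H dim_psubset[of H H'] by (simp add: P_def span_eq_iff[THEN iffD2])
    ultimately show False using max by fastforce
  qed
  thus ?thesis using H by (simp add: P_def)
qed

text \<open>Let \<open>A\<close> be a proper ideal of \<open>I\<close> of largest dimension. Engel
  on the quotient gives \<open>b\<close> outside \<open>A\<close> whose products with
  \<open>I\<close> lie in \<open>A\<close>. Then \<open>A\<close> and \<open>b\<close> span
  \<open>I\<close> by maximality, so all products of \<open>I\<close> fall into
  \<open>A\<close>.\<close>

lemma engel_imp_not_perfect:
  assumes I: "subspace I" "\<And>a b. a \<in> I \<Longrightarrow> b \<in> I \<Longrightarrow> \<mu> a b \<in> I" "engel I" "I \<noteq> {0}"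
  shows "span {\<mu> a b | a b. a \<in> I \<and> b \<in> I} \<noteq> I"
proof
  assume perfect: "span {\<mu> a b | a b. a \<in> I \<and> b \<in> I} = I"
  define P where "P A \<longleftrightarrow> subspace A \<and> A \<subset> I \<and> (\<forall>a\<in>A. \<forall>h\<in>I. \<mu> a h \<in> A)" for A
  have "P {0}" using I by (auto simp: P_def mu_simps subspace_0)
  then obtain A where A: "P A" and max: "\<And>A'. P A' \<Longrightarrow> dim A' \<le> dim A"
    by (rule obtain_max_dim) (rule that)
  from A have A_sub: "subspace A" "A \<subset> I"
      and A_stable: "\<And>a h. a \<in> A \<Longrightarrow> h \<in> I \<Longrightarrow> \<mu> a h \<in> A"
    unfolding P_def by blast+
  from engelE[OF I(3) A_sub(1) I(1) A_sub(2) A_stable I(2)]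
  obtain b where b: "b \<in> I" "b \<notin> A" "\<And>h. h \<in> I \<Longrightarrow> \<mu> b h \<in> A" by blast
  define A' where "A' = span (insert b A)"
  have bracket: "\<mu> a h \<in> A" if a: "a \<in> A'" and h: "h \<in> I" for a h
  proof -
    obtain r where "a - scale r b \<in> span A"
      using a by (auto simp: A'_def span_breakdown_eq)
    moreover have "span A = A" using A_sub by simp
    ultimately have "\<mu> (a - scale r b) h \<in> A" using A_stable h by simp
    hence "\<mu> (a - scale r b) h + scale r (\<mu> b h) \<in> A"
      using b(3)[OF h] A_sub by (intro subspace_add subspace_scale)
    thus ?thesis by (simp add: mu_simps)
  qed
  have sub: "A \<subset> A'" using b(2) by (auto simp: A'_def intro: span_base)
  have "A' \<subseteq> I" unfolding A'_def using A I(1) b(1) by (intro span_minimal) (auto simp: P_def)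
  moreover have "dim A < dim A'" using sub A_sub dim_psubset[of A A'] by (simp add: A'_def span_eq_iff[THEN iffD2])
  hence "\<not> P A'" using max by fastforce
  ultimately have "A' = I" using bracket sub unfolding P_def A'_def by auto
  hence "span {\<mu> a b | a b. a \<in> I \<and> b \<in> I} \<subseteq> A"
    using bracket A by (intro span_minimal) (auto simp: P_def)
  thus False using perfect A by (auto simp: P_def)
qed

end

section \<open>Cartan's criterion\<close>

lemma nilpotent_if_perfect_in_radical:
  fixes scale :: "'k::field_char_0 \<Rightarrow> 'v::ab_group_add \<Rightarrow> 'v"
  assumes "leibniz_algebra scale n e \<mu>"
    and ideal: "algebra_ideal scale \<mu> I"
    and perfect: "Modules.module.span scale {\<mu> a b | a b. a \<in> I \<and> b \<in> I} = I"
    and radical: "\<And>a b. a \<in> I \<Longrightarrow> killing_form scale \<mu> a b = 0"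
    and x: "x \<in> I"
  shows "(right_mult \<mu> x ^^ n) v = 0"
proof -
  interpret leibniz_algebra scale n e \<mu> by (rule assms)
  \<comment> \<open>Eigenvalues require an algebraic closure; injectivity of the embedding brings
    nilpotency back to the original field.\<close>
  interpret to_ac: inj_comm_ring_hom "to_ac :: 'k \<Rightarrow> 'k alg_closure"
    by unfold_locales auto
  define L where "L a = map_mat to_ac (RM a)" for a
  have L [simp]: "L a \<in> carrier_mat n n" for a by (simp add: L_def)
  have LL: "L a * L b = map_mat to_ac (RM a * RM b)" for a b
    unfolding L_def by (rule to_ac.mat_hom_mult[OF RM_carrier RM_carrier, symmetric])
  have L_mu: "L (\<mu> a b) = L b * L a - L a * L b" for a b
  proof -
    have "map_mat to_ac (A - B) = map_mat to_ac A - map_mat to_ac B"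
      if "A \<in> carrier_mat n n" "B \<in> carrier_mat n n" for A B :: "'k mat"
      using that by (intro eq_matI) auto
    thus ?thesis unfolding LL unfolding L_def RM_mu by (simp add: mult_carrier_mat[OF RM_carrier RM_carrier])
  qed
  have L_add: "L (a + b) = L a + L b" and L_scale: "L (scale r a) = to_ac r \<cdot>\<^sub>m L a" for a b r
    unfolding L_def RM_add RM_scale using RM_carrier[of a] RM_carrier[of b] by (auto intro!: eq_matI)
  have "L x ^\<^sub>m n = 0\<^sub>m n n"
  proof (rule nilpotent_if_orthogonal_replicas[OF L])
    fix Y assume Y: "Y \<in> carrier_mat n n" and rep: "replica n (L x) Y"
    \<comment> \<open>The test sequence consists of the matrices of \<open>(R x ^^ j) u\<close>.
      These elements stay in \<open>I\<close>, so their traces against \<open>L v\<close> vanish by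
      the radical hypothesis, and skew-adjointness moves the commutator with \<open>Y\<close> onto
      \<open>L (\<mu> u v)\<close>.\<close>
    have bracket: "mtrace (L (\<mu> u v) * Y) = 0" if "u \<in> I" for u v
    proof -
      have "mtrace (L ((R x ^^ 0) u) * (Y * L v - L v * Y)) = 0"
      proof (rule rep[unfolded replica_def, rule_format])
        show "L ((R x ^^ j) u) \<in> carrier_mat n n \<and>
            L ((R x ^^ Suc j) u) = L x * L ((R x ^^ j) u) - L ((R x ^^ j) u) * L x" for j
          by (simp add: L_mu[symmetric] right_mult_def)
        have "(R x ^^ j) u \<in> I" for j
          by (induction j) (use that ideal in \<open>auto simp: right_mult_def algebra_ideal_def\<close>)
        hence "\<kappa> ((R x ^^ j) u) v = 0" for j using radical by blast
        thus "mtrace (L ((R x ^^ j) u) * L v) = 0" for j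
          unfolding LL killing_form_RM using mtrace_map_to_ac[OF mult_carrier_mat[OF RM_carrier RM_carrier]] by simp
      qed simp
      thus ?thesis unfolding L_mu using mtrace_mult_commutator[OF L L Y] by simp
    qed
    \<comment> \<open>Perfectness enters here: \<open>x\<close> itself is a combination of products,
      so the identity for products reaches it.\<close>
    have "mtrace (L y * Y) = 0" if "y \<in> span {\<mu> a b | a b. a \<in> I \<and> b \<in> I}" for y
      using that
    proof (induction rule: span_induct_alt)
      case base
      have "L 0 = 0\<^sub>m n n" unfolding L_def RM_zero by (intro eq_matI) auto
      thus ?case using Y by (simp add: left_mult_zero_mat[OF Y] mtrace_def)
    next
      case (step r a b)
      then obtain u v where "u \<in> I" "a = \<mu> u v" by blast
      hence "mtrace (L a * Y) = 0" using bracket by blast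
      thus ?case using step(2)
        by (simp add: L_add L_scale add_mult_distrib_mat[OF _ _ Y, of _ n] mult_smult_assoc_mat[OF _ Y, of _ n]
            mtrace_add[of _ n] mtrace_smult[of _ n] mult_carrier_mat[OF _ Y, of _ n])
    qed
    thus "mtrace (L x * Y) = 0" using x unfolding perfect by blast
  qed
  hence "map_mat to_ac (RM x ^\<^sub>m n) = map_mat to_ac (0\<^sub>m n n :: 'k mat)"
    unfolding L_def to_ac.mat_hom_pow[OF RM_carrier, symmetric] by (auto intro!: eq_matI)
  hence "RM x ^\<^sub>m n = 0\<^sub>m n n" by (rule to_ac.mat_hom_inj)
  hence "mat_of (R x ^^ n) = 0\<^sub>m n n" "endo (R x ^^ n)" using mat_of_funpow[OF endo_R] by (simp_all add: RM_def)
  thus ?thesis by (intro mat_of_eq_0D)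
qed

lemma cartan_criterion:
  fixes scale :: "'k::field_char_0 \<Rightarrow> 'v::ab_group_add \<Rightarrow> 'v"
  assumes "alternating_leibniz_algebra scale n e \<mu>"
    and ideal: "algebra_ideal scale \<mu> K"
    and radical: "\<And>a b. a \<in> K \<Longrightarrow> killing_form scale \<mu> a b = 0"
  shows "solvable_subalgebra scale \<mu> K"
proof (rule ccontr)
  interpret alternating_leibniz_algebra scale n e \<mu> by (rule assms)
  assume not_solvable: "\<not> solvable_subalgebra scale \<mu> K"
  define D where "D = derived_series scale \<mu> K"
  \<comment> \<open>At a term of least dimension the decreasing series is constant, so this term is
    perfect; it is nonzero because \<open>K\<close> is assumed not solvable.\<close>
  obtain k where k: "\<And>l. dim (D k) \<le> dim (D l)"
    using ex_has_least_nat[of "\<lambda>_. True" _ "\<lambda>k. dim (D k)"] by auto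
  have ideal_D: "algebra_ideal scale \<mu> (D l)" for l
    unfolding D_def by (rule algebra_ideal_derived_series[OF ideal])
  have sub: "D (Suc l) \<subseteq> D l" for l
    unfolding D_def by (rule derived_series_Suc_subset[OF ideal])
  have "D (Suc k) = D k"
    using ideal_D sub k by (intro subspace_dim_equal) (auto simp: algebra_ideal_def)
  hence perfect: "span {\<mu> a b | a b. a \<in> D k \<and> b \<in> D k} = D k" by (simp add: D_def)
  have "D l \<subseteq> K" for l by (induction l) (use sub in \<open>auto simp: D_def\<close>)
  hence "(right_mult \<mu> x ^^ n) v = 0" if "x \<in> D k" for x v
    using nilpotent_if_perfect_in_radical[OF leibniz_algebra_axioms ideal_D perfect _ that] radical by blast
  hence "engel (D k)"
    by (intro engel_nilpotent) (use ideal_D[of k] in \<open>auto simp: algebra_ideal_def\<close>)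
  moreover have "D k \<noteq> {0}" using not_solvable by (auto simp: solvable_subalgebra_def D_def)
  ultimately show False
    using engel_imp_not_perfect[of "D k"] perfect ideal_D[of k] by (auto simp: algebra_ideal_def)
qed

theorem theorem2p5:
  fixes scale :: "'k::field_char_0 \<Rightarrow> 'v::ab_group_add \<Rightarrow> 'v"
    and n :: nat
    and e :: "nat \<Rightarrow> 'v"
    and \<mu> :: "'v \<Rightarrow> 'v \<Rightarrow> 'v"
  assumes "vector_space scale"
    and "indexed_basis scale n e"
    and "\<mu> \<in> Leib scale"
  shows "(det (gram_matrix n e (killing_form scale \<mu>)) \<noteq> 0 \<longleftrightarrow>
            nondegenerate (killing_form scale \<mu>)) \<and>
         (det (gram_matrix n e (killing_form scale \<mu>)) \<noteq> 0 \<longleftrightarrow>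
            semisimple_lie_algebra scale \<mu>)"
proof -
  interpret vector_space scale by (rule assms)
  interpret leibniz_algebra scale n e \<mu> by unfold_locales (rule assms)+
  have "semisimple_lie_algebra scale \<mu>" if nd: "nondegenerate \<kappa>"
  proof -
    interpret alternating_leibniz_algebra scale n e \<mu>
      by unfold_locales (rule nondegenerate_imp_alternating[OF nd])
    show ?thesis unfolding semisimple_lie_algebra_def
      using alternating_imp_lie_algebra[OF alternating] nondegenerate_imp_no_solvable_ideal[OF nd] by blast
  qed
  moreover have "nondegenerate \<kappa>" if ss: "semisimple_lie_algebra scale \<mu>"
  proof -
    interpret alternating_leibniz_algebra scale n e \<mu>
      by unfold_locales (use ss in \<open>auto simp: semisimple_lie_algebra_def lie_algebra_def\<close>)
    \<comment> \<open>The radical of the form is an ideal by invariance and solvable by Cartan's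
      criterion, so semisimplicity makes it zero.\<close>
    define K where "K = {a. \<forall>b. \<kappa> a b = 0}"
    have ideal: "algebra_ideal scale \<mu> K"
      by (rule algebra_idealI)
        (auto simp: K_def subspace_def killing_form_zero killing_form_add killing_form_scale killing_form_invariant)
    have "solvable_subalgebra scale \<mu> K"
      by (rule cartan_criterion[OF alternating_leibniz_algebra_axioms ideal]) (simp add: K_def)
    hence "K = {0}" using ss ideal by (simp add: semisimple_lie_algebra_def)
    thus ?thesis unfolding nondegenerate_killing_form_iff K_def by blast
  qed
  ultimately show ?thesis using det_gram_matrix_eq_0_iff by blast
qed

end
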